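(* (Saito's criterion.) Let $\mathcal{A}$ be a finite central arrangement in an $\ell$-dimensional Euclidean space $V$, $m:\mathcal{A}\to\mathbb{Z}$ a multiplicity, and let $D\Omega(\mathcal{A},m)$ be the generalized logarithmic module with respect to a fixed inner product $I^*$ on $V^*$. For $\theta_1,\dots,\theta_\ell\in D\Omega(\mathcal{A},m)$ let $M(\theta_1,\dots,\theta_\ell)$ be the $\ell\times\ell$ matrix whose $(i,j)$ entry is $\theta_j(x_i)$. Then the following are equivalent: (1) $\{\theta_1,\dots,\theta_\ell\}$ forms a basis of the $S$-module $D\Omega(\mathcal{A},m)$. (2) $\det M(\theta_1,\dots,\theta_\ell)=c\cdot\dfrac{Q_+}{Q_-}$ for some $c\in\mathbb{C}\setminus\{0\}$.
   Context: $V$ is an $\ell$-dimensional real vector space with a fixed inner product $I^*$ on $V^*$; $x_1,\dots,x_\ell$ is a basis of $V^*$; $S=\mathrm{Sym}(V^* )\otimes_{\mathbb{R}}\mathbb{C}\simeq\mathbb{C}[x_1,\dots,x_\ell]$, $\mathrm{Der}_{\mathbb{C}}(S)=\bigoplus_i S\,\partial_{x_i}$, $\Omega^1_V=\bigoplus_i S\,dx_i$; the subscript $(0)$ denotes localization at the ideal $(0)$ (coefficients in the fraction field of $S$). A central arrangement $\mathcal{A}$ is a finite set of linear hyperplanes in $V$; for each $H\in\mathcal{A}$ fix $\alpha_H\in V^*$ with $\ker\alpha_H=H$. For a finite set $\mathcal{B}$ of linear hyperplanes and $n:\mathcal{B}\to\mathbb{Z}_{\ge 0}$, put $Q(\mathcal{B},n)=\prod_{H\in\mathcal{B}}\alpha_H^{n(H)}$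 and $$D(\mathcal{B},n)=\{\theta\in\mathrm{Der}_{\mathbb{C}}(S)\mid \theta(\alpha_H)\in S\alpha_H^{n(H)}\ \forall H\in\mathcal{B}\},$$ $$\Omega^1(\mathcal{B},n)=\{\omega\in \tfrac{1}{Q(\mathcal{B},n)}\Omega^1_V\mid d\alpha_H\wedge\omega \text{ is regular (has no pole) along } H\ \forall H\in\mathcal{B}\}.$$ The inner product induces an $S$-linear isomorphism $I^*:\Omega^1_V\to\mathrm{Der}_{\mathbb{C}}(S)$, $I^*(\omega)(f)=I^*(\omega,df)$ (with $I^*$ extended $S$-bilinearly), and likewise $I^*:(\Omega^1_V)_{(0)}\to \mathrm{Der}_{\mathbb{C}}(S)_{(0)}$. For a multiplicity $m:\mathcal{A}\to\mathbb{Z}$ let $\mathcal{A}_+=\{H: m(H)>0\}$, $\mathcal{A}_-=\{H: m(H)<0\}$, $Q_+=\prod_{H\in\mathcal{A}_+}\alpha_H^{m(H)}$, $Q_-=\prod_{H\in\mathcal{A}_-}\alpha_H^{-m(H)}$, and for $\mu\in\{+,-\}$ let $m_\mu(H)=m(H)$ if $H\in\mathcal{A}_\mu$ and $m_\mu(H)=0$ otherwise. The generalized logarithmic module is the $S$-module $$D\Omega(\mathcal{A},m)=\tfrac{1}{Q_-}D(\mathcal{A}_+,m_+)\cap I^*(\Omega^1(\mathcal{A}_-,-m_-))\subset \mathrm{Der}_{\mathbb{C}}(S)_{(0)}.$$ *)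

theory Defs
  imports
    "HOL-Analysis.Analysis"
    "HOL-Library.Poly_Mapping"
    "HOL-Computational_Algebra.Polynomial_Factorial"
begin

section \<open>The polynomial ring and its fraction field\<close>

text \<open>
  \<open>'n S\<close> is the ring of complex polynomials in variables indexed by \<open>'n\<close>: a polynomial maps
  exponent vectors to coefficients.  Index types carry a linear order because the library
  needs one to know that \<open>'n S\<close> is an integral domain.
\<close>

type_synonym 'n S = "('n \<Rightarrow>\<^sub>0 nat) \<Rightarrow>\<^sub>0 complex"
type_synonym 'n K = "'n S fract"
type_synonym 'n S_vec = "('n S, 'n) vec"
type_synonym 'n K_vec = "('n K, 'n) vec"
type_synonym 'n K_mat = "(('n K, 'n) vec, 'n) vec"

definition pconst :: "complex \<Rightarrow> 'n S" where
  "pconst c = Poly_Mapping.single 0 c"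

definition pvar :: "'n \<Rightarrow> 'n S" where
  "pvar i = Poly_Mapping.single (Poly_Mapping.single i 1) 1"

definition partial :: "'n \<Rightarrow> 'n S \<Rightarrow> 'n S" where
  "partial i p = (\<Sum>t\<in>Poly_Mapping.keys p.
     Poly_Mapping.single (t - Poly_Mapping.single i 1)
       (of_nat (Poly_Mapping.lookup t i) * Poly_Mapping.lookup p t))"

text \<open>
  The inclusion of \<open>V\<^sup>*\<close> in \<open>S\<close> determined by a basis \<open>x\<close> of \<open>V\<^sup>*\<close>: it sends \<open>x i\<close> to \<open>pvar i\<close>.
\<close>

definition linform :: "('n::finite \<Rightarrow> 'v::euclidean_space \<Rightarrow>\<^sub>L real) \<Rightarrow> ('v \<Rightarrow>\<^sub>L real) \<Rightarrow> 'n S" where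
  "linform x f = (\<Sum>i\<in>UNIV. pconst (complex_of_real (representation (range x) f (x i))) * pvar i)"

section \<open>Derivations and differential forms\<close>

text \<open>
  A vector \<open>v\<close> over \<open>S\<close> or over \<open>K\<close> stands for the derivation with coefficient \<open>v $ i\<close> at
  \<open>\<partial>/\<partial>x\<^sub>i\<close>, or for the 1-form with coefficient \<open>v $ i\<close> at \<open>dx\<^sub>i\<close>.
\<close>

definition vec_to_fract :: "'n S_vec \<Rightarrow> ('n::{finite,linorder}) K_vec" where
  "vec_to_fract v = (\<chi> i. to_fract (v $ i))"

definition der_apply :: "'n S_vec \<Rightarrow> 'n S \<Rightarrow> ('n::finite) S" where
  "der_apply \<theta> f = (\<Sum>i\<in>UNIV. \<theta> $ i * partial i f)"

definition der_apply_fract :: "'n K_vec \<Rightarrow> 'n S \<Rightarrow> ('n::{finite,linorder}) K" where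
  "der_apply_fract \<theta> f = (\<Sum>i\<in>UNIV. \<theta> $ i * to_fract (partial i f))"

definition differential :: "'n S \<Rightarrow> ('n::{finite,linorder}) K_vec" where
  "differential f = (\<chi> i. to_fract (partial i f))"

text \<open>Entry \<open>(i, j)\<close> of a 2-form, \<open>i < j\<close>, is its coefficient at \<open>dx\<^sub>i \<and> dx\<^sub>j\<close>.\<close>

definition wedge :: "'n K_vec \<Rightarrow> 'n K_vec \<Rightarrow> ('n::{finite,linorder}) K_mat" where
  "wedge \<omega> \<eta> = (\<chi> i j. \<omega> $ i * \<eta> $ j - \<omega> $ j * \<eta> $ i)"

text \<open>
  For a prime \<open>a\<close>: no pole along \<open>a = 0\<close>, i.e. membership in the localization of \<open>S\<close> at \<open>(a)\<close>.
\<close>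

definition regular_along :: "'n S \<Rightarrow> ('n::{finite,linorder}) K \<Rightarrow> bool" where
  "regular_along a f \<longleftrightarrow> (\<exists>p q. \<not> a dvd q \<and> f = to_fract p / to_fract q)"

definition regular_2form_along :: "'n S \<Rightarrow> ('n::{finite,linorder}) K_mat \<Rightarrow> bool" where
  "regular_2form_along a \<eta> \<longleftrightarrow> (\<forall>i j. regular_along a (\<eta> $ i $ j))"

section \<open>The inner product on the dual space\<close>

definition inner_product_on_type :: "('w::real_vector \<Rightarrow> 'w \<Rightarrow> real) \<Rightarrow> bool" where
  "inner_product_on_type I \<longleftrightarrow>
     bilinear I \<and> (\<forall>f g. I f g = I g f) \<and> (\<forall>f. f \<noteq> 0 \<longrightarrow> I f f > 0)"

text \<open>The bilinear extension of \<open>I\<close> to rational 1-forms, where \<open>x i\<close> in \<open>V\<^sup>*\<close> corresponds to \<open>dx\<^sub>i\<close>.\<close>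

definition form_pairing ::
  "('n \<Rightarrow> 'v::euclidean_space \<Rightarrow>\<^sub>L real) \<Rightarrow> (('v \<Rightarrow>\<^sub>L real) \<Rightarrow> ('v \<Rightarrow>\<^sub>L real) \<Rightarrow> real) \<Rightarrow>
   'n K_vec \<Rightarrow> 'n K_vec \<Rightarrow> ('n::{finite,linorder}) K" where
  "form_pairing x I \<omega> \<eta> =
     (\<Sum>i\<in>UNIV. \<Sum>j\<in>UNIV. \<omega> $ i * \<eta> $ j * to_fract (pconst (complex_of_real (I (x i) (x j)))))"

text \<open>
  The isomorphism from 1-forms to derivations.  The coefficient of a derivation at \<open>\<partial>/\<partial>x\<^sub>i\<close> is
  its value on \<open>x\<^sub>i\<close>; lemma \<open>form_to_der_apply\<close> gives its value on an arbitrary polynomial.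
\<close>

definition form_to_der ::
  "('n \<Rightarrow> 'v::euclidean_space \<Rightarrow>\<^sub>L real) \<Rightarrow> (('v \<Rightarrow>\<^sub>L real) \<Rightarrow> ('v \<Rightarrow>\<^sub>L real) \<Rightarrow> real) \<Rightarrow>
   'n K_vec \<Rightarrow> ('n::{finite,linorder}) K_vec" where
  "form_to_der x I \<omega> = (\<chi> i. form_pairing x I \<omega> (differential (pvar i)))"

lemma partial_pvar: "partial i (pvar j) = (if i = j then 1 else 0)"
proof -
  have "Poly_Mapping.single (0 :: 'a \<Rightarrow>\<^sub>0 nat) (1::complex) = 1"
    by simp
  then show ?thesis
    by (auto simp: partial_def pvar_def lookup_single when_def)
qed

lemma form_to_der_apply:
  "der_apply_fract (form_to_der x I \<omega>) f = form_pairing x I \<omega> (differential f)"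
proof -
  let ?c = "\<lambda>i j. to_fract (pconst (complex_of_real (I (x i) (x j))))"
  have *: "form_to_der x I \<omega> $ i = (\<Sum>k\<in>UNIV. \<omega> $ k * ?c k i)" for i
  proof -
    have "(\<Sum>j\<in>UNIV. \<omega> $ k * to_fract (partial j (pvar i)) * ?c k j) = \<omega> $ k * ?c k i" for k
    proof -
      have "(\<Sum>j\<in>UNIV. \<omega> $ k * to_fract (partial j (pvar i)) * ?c k j)
          = (\<Sum>j\<in>UNIV. if j = i then \<omega> $ k * ?c k j else 0)"
        by (rule sum.cong) (auto simp: partial_pvar)
      then show ?thesis by simp
    qed
    then show ?thesis
      by (simp add: form_to_der_def form_pairing_def differential_def)
  qed
  show ?thesis
    unfolding der_apply_fract_def * form_pairing_def differential_def
    by (subst sum.swap) (simp add: sum_distrib_right sum_distrib_left ac_simps)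
qed

section \<open>Logarithmic modules\<close>

definition linear_hyperplane :: "'v::euclidean_space set \<Rightarrow> bool" where
  "linear_hyperplane H \<longleftrightarrow> subspace H \<and> dim H + 1 = DIM('v)"

definition Q_poly ::
  "('n \<Rightarrow> 'v::euclidean_space \<Rightarrow>\<^sub>L real) \<Rightarrow> ('v set \<Rightarrow> 'v \<Rightarrow>\<^sub>L real) \<Rightarrow>
   'v set set \<Rightarrow> ('v set \<Rightarrow> nat) \<Rightarrow> ('n::finite) S" where
  "Q_poly x \<alpha> B n = (\<Prod>H\<in>B. linform x (\<alpha> H) ^ n H)"

definition log_der ::
  "('n \<Rightarrow> 'v::euclidean_space \<Rightarrow>\<^sub>L real) \<Rightarrow> ('v set \<Rightarrow> 'v \<Rightarrow>\<^sub>L real) \<Rightarrow>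
   'v set set \<Rightarrow> ('v set \<Rightarrow> nat) \<Rightarrow> (('n::finite) S_vec) set" where
  "log_der x \<alpha> B n =
     {\<theta>. \<forall>H\<in>B. linform x (\<alpha> H) ^ n H dvd der_apply \<theta> (linform x (\<alpha> H))}"

definition log_form ::
  "('n \<Rightarrow> 'v::euclidean_space \<Rightarrow>\<^sub>L real) \<Rightarrow> ('v set \<Rightarrow> 'v \<Rightarrow>\<^sub>L real) \<Rightarrow>
   'v set set \<Rightarrow> ('v set \<Rightarrow> nat) \<Rightarrow> (('n::{finite,linorder}) K_vec) set" where
  "log_form x \<alpha> B n =
     {\<omega>. (\<exists>\<eta>. \<omega> = (1 / to_fract (Q_poly x \<alpha> B n)) *s vec_to_fract \<eta>) \<and>
         (\<forall>H\<in>B. regular_2form_along (linform x (\<alpha> H))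
                   (wedge (differential (linform x (\<alpha> H))) \<omega>))}"

definition pos_part :: "'h set \<Rightarrow> ('h \<Rightarrow> int) \<Rightarrow> 'h set" where
  "pos_part A m = {H \<in> A. m H > 0}"

definition neg_part :: "'h set \<Rightarrow> ('h \<Rightarrow> int) \<Rightarrow> 'h set" where
  "neg_part A m = {H \<in> A. m H < 0}"

text \<open>\<open>pos_mult m\<close> is \<open>m\<^sub>+\<close> and \<open>neg_mult m\<close> is \<open>- m\<^sub>-\<close>; recall that \<open>nat\<close> truncates at 0.\<close>

definition pos_mult :: "('h \<Rightarrow> int) \<Rightarrow> 'h \<Rightarrow> nat" where
  "pos_mult m H = nat (m H)"

definition neg_mult :: "('h \<Rightarrow> int) \<Rightarrow> 'h \<Rightarrow> nat" where
  "neg_mult m H = nat (- m H)"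

definition Q_pos ::
  "('n \<Rightarrow> 'v::euclidean_space \<Rightarrow>\<^sub>L real) \<Rightarrow> ('v set \<Rightarrow> 'v \<Rightarrow>\<^sub>L real) \<Rightarrow>
   'v set set \<Rightarrow> ('v set \<Rightarrow> int) \<Rightarrow> ('n::finite) S" where
  "Q_pos x \<alpha> A m = Q_poly x \<alpha> (pos_part A m) (pos_mult m)"

definition Q_neg ::
  "('n \<Rightarrow> 'v::euclidean_space \<Rightarrow>\<^sub>L real) \<Rightarrow> ('v set \<Rightarrow> 'v \<Rightarrow>\<^sub>L real) \<Rightarrow>
   'v set set \<Rightarrow> ('v set \<Rightarrow> int) \<Rightarrow> ('n::finite) S" where
  "Q_neg x \<alpha> A m = Q_poly x \<alpha> (neg_part A m) (neg_mult m)"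

definition gen_log_module ::
  "('n \<Rightarrow> 'v::euclidean_space \<Rightarrow>\<^sub>L real) \<Rightarrow> (('v \<Rightarrow>\<^sub>L real) \<Rightarrow> ('v \<Rightarrow>\<^sub>L real) \<Rightarrow> real) \<Rightarrow>
   ('v set \<Rightarrow> 'v \<Rightarrow>\<^sub>L real) \<Rightarrow> 'v set set \<Rightarrow> ('v set \<Rightarrow> int) \<Rightarrow>
   (('n::{finite,linorder}) K_vec) set" where
  "gen_log_module x I \<alpha> A m =
     (\<lambda>\<theta>. (1 / to_fract (Q_neg x \<alpha> A m)) *s vec_to_fract \<theta>)
         ` log_der x \<alpha> (pos_part A m) (pos_mult m)
     \<inter> form_to_der x I ` log_form x \<alpha> (neg_part A m) (neg_mult m)"

section \<open>Bases and the coefficient matrix\<close>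

definition S_scale :: "'n S \<Rightarrow> 'n K_vec \<Rightarrow> ('n::{finite,linorder}) K_vec" where
  "S_scale s v = to_fract s *s v"

lemma module_S_scale: "module S_scale"
  by unfold_locales
    (simp_all add: S_scale_def vector_add_ldistrib vector_sadd_rdistrib vector_smult_assoc)

definition is_S_basis ::
  "('n \<Rightarrow> 'n K_vec) \<Rightarrow> (('n::{finite,linorder}) K_vec) set \<Rightarrow> bool" where
  "is_S_basis \<theta> M \<longleftrightarrow>
     inj \<theta> \<and> \<not> module.dependent S_scale (range \<theta>) \<and> module.span S_scale (range \<theta>) = M"

definition coeff_matrix :: "('n \<Rightarrow> 'n K_vec) \<Rightarrow> ('n::{finite,linorder}) K_mat" where
  "coeff_matrix \<theta> = (\<chi> i j. der_apply_fract (\<theta> j) (pvar i))"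

end

theory Submission
  imports Defs
begin

text \<open>
  Let \<open>M\<close> be the \<open>S\<close>-module \<open>Q\<^sub>- D\<Omega>(\<A>,m)\<close>, a submodule of \<open>S\<^sup>\<ell>\<close>, and let \<open>E = Q\<^sub>+ Q\<^sub>-\<^sup>\<ell>\<^sup>-\<^sup>1\<close>.  The
  determinant of any \<open>\<ell>\<close> elements of \<open>M\<close> is divisible by \<open>E\<close>: for each hyperplane \<open>H\<close> a constant
  row operation makes one row (if \<open>m(H) > 0\<close>) or all rows but one (if \<open>m(H) < 0\<close>) divisible by
  \<open>\<alpha>\<^sub>H\<^bsup>|m(H)|\<^esup>\<close>, and the \<open>\<alpha>\<^sub>H\<close> are pairwise non-associated primes.  So if the determinant equals \<open>E\<close> up
  to a constant, Cramer's rule expresses every element of \<open>M\<close> with coefficients in \<open>S\<close>.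
  Conversely, if \<open>\<eta>\<^sub>1, \<dots>, \<eta>\<^sub>\<ell>\<close> span \<open>M\<close>, with determinant \<open>f E\<close>, then \<open>f E\<close> divides the determinant of
  any \<open>\<ell>\<close> elements of \<open>M\<close>.  Explicit elements adapted to a given \<open>H\<close> show that \<open>\<alpha>\<^sub>H\<close> does not divide
  \<open>f\<close>, while \<open>f\<close> divides a product of the \<open>\<alpha>\<^sub>H\<close>; hence \<open>f\<close> is a unit, i.e. a constant.
\<close>

section \<open>Polynomials\<close>

lemma pconst_add: "pconst (a + b) = pconst a + pconst b"
  by (simp add: pconst_def single_add)

lemma pconst_mult: "pconst (a * b) = pconst a * (pconst b :: 'n S)"
  by (simp add: pconst_def mult_single)

lemma pconst_diff: "pconst (a - b) = pconst a - (pconst b :: 'n S)"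
  by (simp add: pconst_def single_diff)

lemma pconst_0 [simp]: "pconst 0 = 0"
  by (simp add: pconst_def)

lemma pconst_1 [simp]: "pconst 1 = 1"
  by (simp add: pconst_def)

lemma pconst_eq_0_iff [simp]: "pconst c = 0 \<longleftrightarrow> c = 0"
  by (metis lookup_single_eq pconst_0 pconst_def lookup_zero)

lemma pconst_sum: "pconst (sum f A) = (\<Sum>i\<in>A. pconst (f i))"
  by (induction A rule: infinite_finite_induct) (simp_all add: pconst_add)

lemma sum_singles_keys:
  "(\<Sum>t\<in>Poly_Mapping.keys p. Poly_Mapping.single t (Poly_Mapping.lookup p t)) = p"
  by (rule poly_mapping_eqI)
    (auto simp: lookup_sum lookup_single when_def in_keys_iff intro: sum.neutral)

lemma pvar_power: "pvar i ^ k = Poly_Mapping.single (Poly_Mapping.single i k) 1"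
proof (induction k)
  case (Suc k)
  then show ?case
    by (simp add: pvar_def mult_single flip: single_add)
qed simp

lemma single_conv_pvar:
  fixes t :: "'n::finite \<Rightarrow>\<^sub>0 nat"
  shows "Poly_Mapping.single t c = pconst c * (\<Prod>i\<in>UNIV. pvar i ^ Poly_Mapping.lookup t i)"
proof -
  have "(\<Prod>i\<in>J. pvar i ^ Poly_Mapping.lookup t i)
      = Poly_Mapping.single (\<Sum>i\<in>J. Poly_Mapping.single i (Poly_Mapping.lookup t i)) 1"
    if "finite J" for J
    using that by induction (auto simp: pvar_power mult_single)
  moreover have "(\<Sum>i\<in>UNIV. Poly_Mapping.single i (Poly_Mapping.lookup t i)) = t"
    by (rule poly_mapping_eqI) (simp add: lookup_sum lookup_single when_def)
  ultimately show ?thesis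
    by (simp add: pconst_def mult_single)
qed

text \<open>Addition of exponents is strictly monotone, so among all products of a term of
  \<open>f\<close> with a term of \<open>g\<close> only the two leading terms reach the exponent
  \<open>a + b\<close>. Their coefficients have a nonzero product, and nothing in \<open>?r\<close>
  can cancel it.\<close>

lemma leading_key_mult:
  fixes f g :: "('a::{ordered_cancel_comm_monoid_add,linorder}) \<Rightarrow>\<^sub>0 'b::semiring_no_zero_divisors"
  assumes "f \<noteq> 0" "g \<noteq> 0"
  shows "Max (Poly_Mapping.keys f) + Max (Poly_Mapping.keys g) \<in> Poly_Mapping.keys (f * g)"
proof -
  define a b where "a = Max (Poly_Mapping.keys f)" and "b = Max (Poly_Mapping.keys g)"
  define f' where "f' = (\<Sum>t\<in>Poly_Mapping.keys f - {a}. Poly_Mapping.single t (Poly_Mapping.lookup f t))"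
  define g' where "g' = (\<Sum>t\<in>Poly_Mapping.keys g - {b}. Poly_Mapping.single t (Poly_Mapping.lookup g t))"
  have ab: "a \<in> Poly_Mapping.keys f" "b \<in> Poly_Mapping.keys g"
    using assms by (auto simp: a_def b_def intro!: Max_in)
  have f: "f = Poly_Mapping.single a (Poly_Mapping.lookup f a) + f'"
    unfolding f'_def using ab by (subst (1) sum_singles_keys[of f, symmetric]) (simp add: sum.remove[of _ a])
  have g: "g = Poly_Mapping.single b (Poly_Mapping.lookup g b) + g'"
    unfolding g'_def using ab by (subst (1) sum_singles_keys[of g, symmetric]) (simp add: sum.remove[of _ b])
  have le: "t \<in> Poly_Mapping.keys f \<Longrightarrow> t \<le> a" "t \<in> Poly_Mapping.keys g \<Longrightarrow> t \<le> b" for t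
    by (auto simp: a_def b_def)
  have f': "t < a" if "t \<in> Poly_Mapping.keys f'" for t
    using that keys_sum[of "\<lambda>t. Poly_Mapping.single t (Poly_Mapping.lookup f t)" "Poly_Mapping.keys f - {a}"] le(1)[of t]
    by (auto simp: f'_def split: if_splits)
  have g': "t < b" if "t \<in> Poly_Mapping.keys g'" for t
    using that keys_sum[of "\<lambda>t. Poly_Mapping.single t (Poly_Mapping.lookup g t)" "Poly_Mapping.keys g - {b}"] le(2)[of t]
    by (auto simp: g'_def split: if_splits)
  let ?r = "Poly_Mapping.single a (Poly_Mapping.lookup f a) * g' + f' * g"
  have "f * g = Poly_Mapping.single a (Poly_Mapping.lookup f a)
      * (Poly_Mapping.single b (Poly_Mapping.lookup g b) + g') + f' * g"
    using f g by (metis distrib_right)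
  also have "\<dots> = Poly_Mapping.single (a + b) (Poly_Mapping.lookup f a * Poly_Mapping.lookup g b) + ?r"
    by (simp add: distrib_left mult_single add.assoc)
  finally have fg: "f * g = \<dots>" .
  have "a + b \<notin> Poly_Mapping.keys (Poly_Mapping.single a (Poly_Mapping.lookup f a) * g')"
  proof
    assume "a + b \<in> Poly_Mapping.keys (Poly_Mapping.single a (Poly_Mapping.lookup f a) * g')"
    then obtain t where "t \<in> Poly_Mapping.keys g'" "a + b = a + t"
      using keys_mult by (fastforce split: if_splits)
    then show False using g' by auto
  qed
  moreover have "a + b \<notin> Poly_Mapping.keys (f' * g)"
  proof
    assume "a + b \<in> Poly_Mapping.keys (f' * g)"
    then obtain s t where "s \<in> Poly_Mapping.keys f'" "t \<in> Poly_Mapping.keys g" "a + b = s + t"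
      using keys_mult by blast
    then show False using f' le(2) add_less_le_mono[of s a t b] by auto
  qed
  ultimately have "Poly_Mapping.lookup ?r (a + b) = 0"
    by (simp add: lookup_add in_keys_iff)
  with ab show ?thesis
    unfolding a_def[symmetric] b_def[symmetric] in_keys_iff fg by (simp add: lookup_add)
qed

text \<open>The leading exponents of a unit and of its inverse add up to 0, the exponent of 1.
  Exponents are natural numbers, so both vanish; as 0 is the least exponent vector, no other
  monomial occurs.\<close>

lemma unit_imp_pconst:
  fixes f :: "('n::{finite,linorder}) S"
  assumes "f dvd 1"
  obtains c where "c \<noteq> 0" "f = pconst c"
proof -
  obtain g where g: "1 = f * g" using assms by (elim dvdE)
  then have nz: "f \<noteq> 0" "g \<noteq> 0" by auto
  let ?a = "Max (Poly_Mapping.keys f)"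
  have "?a + Max (Poly_Mapping.keys g) = 0"
    using leading_key_mult[OF nz] unfolding g[symmetric] by simp
  then have "Poly_Mapping.lookup ?a i + Poly_Mapping.lookup (Max (Poly_Mapping.keys g)) i = 0" for i
    by (metis lookup_add lookup_zero)
  then have a: "?a = 0"
    by (intro poly_mapping_eqI) auto
  have "t = 0" if "t \<in> Poly_Mapping.keys f" for t
  proof -
    have "t \<le> 0" using Max_ge[OF _ that] a by simp
    moreover have "\<not> t < 0" by (simp add: less_poly_mapping.rep_eq less_fun_def)
    ultimately show ?thesis by simp
  qed
  then have "Poly_Mapping.keys f \<subseteq> {0}" by auto
  then have "f = pconst (Poly_Mapping.lookup f 0)"
    by (intro poly_mapping_eqI) (auto simp: pconst_def lookup_single when_def in_keys_iff)
  with nz that show thesis by (metis pconst_0)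
qed

section \<open>Substitution\<close>

text \<open>The ring endomorphism that fixes constants and sends each \<open>pvar i\<close> to
  \<open>g i\<close>.\<close>

definition psubst :: "('n \<Rightarrow> 'n S) \<Rightarrow> 'n S \<Rightarrow> ('n::finite) S" where
  "psubst g p = (\<Sum>t\<in>Poly_Mapping.keys p.
     pconst (Poly_Mapping.lookup p t) * (\<Prod>i\<in>UNIV. g i ^ Poly_Mapping.lookup t i))"

text \<open>Sums over the keys of \<open>p\<close>, \<open>q\<close> and \<open>p + q\<close> become
  comparable once all run over one larger set, since missing keys contribute 0.\<close>

lemma psubst_superset:
  assumes "finite T" "Poly_Mapping.keys p \<subseteq> T"
  shows "psubst g p = (\<Sum>t\<in>T.
     pconst (Poly_Mapping.lookup p t) * (\<Prod>i\<in>UNIV. g i ^ Poly_Mapping.lookup t i))"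
  unfolding psubst_def using assms
  by (intro sum.mono_neutral_left) (auto simp: in_keys_iff)

lemma psubst_add: "psubst g (p + q) = psubst g p + psubst g q"
proof -
  let ?T = "Poly_Mapping.keys p \<union> Poly_Mapping.keys q"
  have "psubst g r = (\<Sum>t\<in>?T.
     pconst (Poly_Mapping.lookup r t) * (\<Prod>i\<in>UNIV. g i ^ Poly_Mapping.lookup t i))"
    if "r \<in> {p, q, p + q}" for r
    using that keys_add[of p q] by (intro psubst_superset) auto
  then show ?thesis
    by (simp add: lookup_add pconst_add distrib_right sum.distrib)
qed

lemma psubst_0 [simp]: "psubst g 0 = 0"
  by (simp add: psubst_def)

lemma psubst_sum: "psubst g (sum f A) = (\<Sum>a\<in>A. psubst g (f a))"
  by (induction A rule: infinite_finite_induct) (simp_all add: psubst_add)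

lemma psubst_single:
  "psubst g (Poly_Mapping.single t c) = pconst c * (\<Prod>i\<in>UNIV. g i ^ Poly_Mapping.lookup t i)"
  by (simp add: psubst_def)

lemma psubst_mult: "psubst g (p * q) = psubst g p * psubst g q"
proof -
  let ?s = "\<lambda>p t. Poly_Mapping.single t (Poly_Mapping.lookup p t)"
  have "psubst g (?s p t * ?s q u) = psubst g (?s p t) * psubst g (?s q u)" for t u
    by (simp add: mult_single psubst_single pconst_mult lookup_add power_add prod.distrib mult_ac)
  then have "psubst g ((\<Sum>t\<in>Poly_Mapping.keys p. ?s p t) * (\<Sum>u\<in>Poly_Mapping.keys q. ?s q u))
      = psubst g (\<Sum>t\<in>Poly_Mapping.keys p. ?s p t) * psubst g (\<Sum>u\<in>Poly_Mapping.keys q. ?s q u)"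
    by (simp add: sum_product psubst_sum)
  then show ?thesis by (simp only: sum_singles_keys)
qed

lemma psubst_pconst [simp]: "psubst g (pconst c) = pconst c"
  by (simp add: pconst_def[of c] psubst_single)

lemma psubst_pvar [simp]: "psubst g (pvar i) = g i"
proof -
  have "(\<Prod>j\<in>UNIV. g j ^ Poly_Mapping.lookup (Poly_Mapping.single i (1::nat)) j)
      = (\<Prod>j\<in>UNIV. if j = i then g j else 1)"
    by (rule prod.cong) (auto simp: lookup_single when_def)
  then show ?thesis by (simp add: pvar_def psubst_single)
qed

lemma dvd_mult_diff:
  fixes a :: "'a::comm_ring_1"
  assumes "a dvd u - v" "a dvd u' - v'"
  shows "a dvd u * u' - v * v'"
proof -
  have "u * u' - v * v' = (u - v) * u' + v * (u' - v')" by (simp add: algebra_simps)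
  with assms show ?thesis by (simp add: dvd_add dvd_mult dvd_mult2)
qed

text \<open>Congruence modulo \<open>a\<close> is preserved by powers, products and sums, so it
  passes from the variables to all polynomials.\<close>

lemma dvd_diff_psubst:
  fixes p :: "('n::finite) S"
  assumes "\<And>i. a dvd pvar i - g i"
  shows "a dvd p - psubst g p"
proof -
  have pow: "a dvd pvar i ^ k - g i ^ k" for i k
    by (induction k) (simp_all add: dvd_mult_diff assms)
  have "a dvd (\<Prod>i\<in>J. pvar i ^ Poly_Mapping.lookup t i) - (\<Prod>i\<in>J. g i ^ Poly_Mapping.lookup t i)"
    if "finite J" for J t
    using that by induction (simp_all add: dvd_mult_diff pow)
  then have "a dvd Poly_Mapping.single t c - psubst g (Poly_Mapping.single t c)" for t c
    unfolding single_conv_pvar psubst_single[unfolded single_conv_pvar]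
    by (simp add: dvd_mult flip: right_diff_distrib)
  then have "a dvd (\<Sum>t\<in>Poly_Mapping.keys p. Poly_Mapping.single t (Poly_Mapping.lookup p t)
      - psubst g (Poly_Mapping.single t (Poly_Mapping.lookup p t)))"
    by (intro dvd_sum)
  then show ?thesis
    by (simp only: sum_subtractf sum_singles_keys flip: psubst_sum)
qed

section \<open>Linear forms\<close>

text \<open>Linear forms given by bare coefficients, detached from functionals on \<open>V\<close>;
  \<open>linform_eq_lin\<close> makes the link.\<close>

definition lin :: "('n \<Rightarrow> complex) \<Rightarrow> ('n::finite) S" where
  "lin c = (\<Sum>i\<in>UNIV. pconst (c i) * pvar i)"

text \<open>\<open>g\<close> solves the equation \<open>lin c = 0\<close> for the variable
  \<open>p\<close>, so the substitution kills \<open>lin c\<close>. Conversely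
  \<open>pvar p - g p\<close> is a constant multiple of \<open>lin c\<close>, so \<open>f\<close>
  and \<open>psubst g f\<close> agree modulo \<open>lin c\<close>. The ideal of \<open>lin c\<close>
  is thus the kernel of a ring homomorphism.\<close>

lemma lin_dvd_iff:
  fixes c :: "'n::{finite,linorder} \<Rightarrow> complex"
  assumes "c p \<noteq> 0"
  defines "g \<equiv> pvar(p := - (\<Sum>i\<in>UNIV - {p}. pconst (c i / c p) * pvar i))"
  shows "lin c dvd f \<longleftrightarrow> psubst g f = 0"
proof
  have "psubst g (lin c) = pconst (c p) * g p + (\<Sum>i\<in>UNIV - {p}. pconst (c i) * g i)"
    by (simp add: lin_def psubst_add psubst_sum psubst_mult sum.remove[of _ p])
  also have "\<dots> = 0"
    using assms(1) by (simp add: g_def sum_distrib_left flip: mult.assoc pconst_mult)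
  finally show "psubst g f = 0" if "lin c dvd f"
    using that by (auto simp: psubst_mult elim!: dvdE)
  have "pvar p - g p = pconst (1 / c p) * lin c"
    using assms(1)
    by (simp add: g_def lin_def distrib_left sum_distrib_left sum.remove[of _ p] flip: mult.assoc pconst_mult)
  then have "lin c dvd f - psubst g f"
    by (intro dvd_diff_psubst) (auto simp: g_def)
  then show "lin c dvd f" if "psubst g f = 0"
    using that by simp
qed

lemma pconst_mult_pvar: "pconst c * pvar i = Poly_Mapping.single (Poly_Mapping.single i 1) c"
  by (simp add: pconst_def pvar_def mult_single)

lemma lookup_lin: "Poly_Mapping.lookup (lin c) (Poly_Mapping.single i 1) = c i"
proof -
  have eq: "Poly_Mapping.single j (1::nat) = Poly_Mapping.single i 1 \<longleftrightarrow> j = i" for j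
    by (auto simp: lookup_single when_def split: if_splits
      dest: arg_cong[where f = "\<lambda>t. Poly_Mapping.lookup t j"])
  show ?thesis
    unfolding lin_def pconst_mult_pvar lookup_sum lookup_single eq by (simp add: when_def)
qed

lemma lin_eq_0_iff: "lin c = 0 \<longleftrightarrow> (\<forall>i. c i = 0)"
proof
  show "\<forall>i. c i = 0" if "lin c = 0"
    using lookup_lin[of c] that by simp
qed (simp add: lin_def)

lemma lin_dvd_linD:
  fixes c d :: "'n::{finite,linorder} \<Rightarrow> complex"
  assumes "c p \<noteq> 0" "lin c dvd lin d"
  shows "d i = d p / c p * c i"
proof -
  \<comment> \<open>The multiple of \<open>lin c\<close> is chosen to make \<open>e p = 0\<close>:
    then \<open>lin e\<close> does not involve the eliminated variable, so the substitution both
    kills it and leaves it unchanged.\<close>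
  define e where "e i = d i - d p / c p * c i" for i
  have "lin e = lin d - pconst (d p / c p) * lin c"
    unfolding lin_def e_def sum_distrib_left sum_subtractf[symmetric]
    by (intro sum.cong) (simp_all only: pconst_diff pconst_mult left_diff_distrib mult.assoc)
  then have "lin c dvd lin e"
    using assms(2) by simp
  then have "psubst (pvar(p := - (\<Sum>i\<in>UNIV - {p}. pconst (c i / c p) * pvar i))) (lin e) = 0"
    using lin_dvd_iff[of c p, OF assms(1)] by blast
  moreover have "psubst (pvar(p := - (\<Sum>i\<in>UNIV - {p}. pconst (c i / c p) * pvar i))) (lin e) = lin e"
    using assms(1) unfolding lin_def psubst_sum psubst_mult
    by (intro sum.cong) (auto simp: e_def)
  ultimately have "e i = 0"
    by (simp add: lin_eq_0_iff)
  then show ?thesis by (simp add: e_def)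
qed

text \<open>The ideal is the kernel of a homomorphism into an integral domain.\<close>

lemma prime_elem_lin:
  fixes c :: "'n::{finite,linorder} \<Rightarrow> complex"
  assumes "c p \<noteq> 0"
  shows "prime_elem (lin c)"
proof (rule prime_elemI)
  show "lin c \<noteq> 0" using assms lin_eq_0_iff by blast
  show "\<not> lin c dvd 1"
    by (simp add: lin_dvd_iff[of c p, OF assms] flip: pconst_1)
  show "lin c dvd a \<or> lin c dvd b" if "lin c dvd a * b" for a b
    using that by (simp add: lin_dvd_iff[of c p, OF assms] psubst_mult)
qed

section \<open>Partial derivatives of linear forms\<close>

lemma partial_superset:
  assumes "finite T" "Poly_Mapping.keys p \<subseteq> T"
  shows "partial i p = (\<Sum>t\<in>T. Poly_Mapping.single (t - Poly_Mapping.single i 1)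
       (of_nat (Poly_Mapping.lookup t i) * Poly_Mapping.lookup p t))"
  unfolding partial_def using assms
  by (intro sum.mono_neutral_left) (auto simp: in_keys_iff)

lemma partial_add: "partial i (p + q) = partial i p + partial i q"
proof -
  let ?T = "Poly_Mapping.keys p \<union> Poly_Mapping.keys q"
  have "partial i r = (\<Sum>t\<in>?T. Poly_Mapping.single (t - Poly_Mapping.single i 1)
       (of_nat (Poly_Mapping.lookup t i) * Poly_Mapping.lookup r t))"
    if "r \<in> {p, q, p + q}" for r
    using that keys_add[of p q] by (intro partial_superset) auto
  then show ?thesis
    by (simp add: lookup_add distrib_left single_add sum.distrib)
qed

lemma partial_sum: "partial i (sum f A) = (\<Sum>a\<in>A. partial i (f a))"
  by (induction A rule: infinite_finite_induct) (simp_all add: partial_add, simp_all add: partial_def)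

lemma partial_lin: "partial i (lin c) = pconst (c i)"
proof -
  have "partial i (pconst (c j) * pvar j) = (if j = i then pconst (c j) else 0)" for j
    unfolding pconst_mult_pvar partial_def
    by (cases "c j = 0") (auto simp: lookup_single pconst_def when_def)
  then show ?thesis
    by (simp add: lin_def partial_sum)
qed

section \<open>Divisibility by powers of primes\<close>

text \<open>One factor at a time: once \<open>x = p ^ k * y\<close>, cancelling \<open>p ^ k\<close>
  leaves \<open>p\<close> dividing \<open>y * q\<close>, hence \<open>y\<close>.\<close>

lemma prime_power_dvd_cancel:
  fixes p :: "'a::idom"
  assumes "prime_elem p" "\<not> p dvd q" "p ^ k dvd x * q"
  shows "p ^ k dvd x"
  using assms(3)
proof (induction k)
  case (Suc k)
  have "p ^ k dvd x * q" using Suc.prems by (rule power_le_dvd) simp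
  then have "p ^ k dvd x" by (rule Suc.IH)
  then obtain y where y: "x = p ^ k * y" by (elim dvdE)
  have "p ^ k * p dvd p ^ k * (y * q)"
    using Suc.prems by (simp add: y mult_ac)
  then have "p dvd y * q"
    using assms(1) by (simp add: dvd_times_left_cancel_iff prime_elem_not_zeroI)
  then have "p dvd y" using assms prime_elem_dvd_multD by blast
  then show ?case by (simp add: y mult.commute[of p])
qed simp

lemma prime_elem_not_dvd_prod_power:
  assumes "prime_elem p" "\<And>b. b \<in> B \<Longrightarrow> \<not> p dvd q b"
  shows "\<not> p dvd (\<Prod>b\<in>B. q b ^ e b)"
  using assms(2)
proof (induction B rule: infinite_finite_induct)
  case (insert b B)
  then have "\<not> p dvd q b ^ e b" "\<not> p dvd (\<Prod>b\<in>B. q b ^ e b)"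
    using prime_elem_dvd_power[OF assms(1)] by auto
  with insert.hyps show ?case
    by (simp add: prime_elem_dvd_mult_iff[OF assms(1)])
qed (use prime_elem_not_unit[OF assms(1)] in simp_all)

text \<open>The new prime does not divide the product already collected, so its whole power must
  divide the cofactor \<open>z\<close>.\<close>

lemma prod_prime_powers_dvd:
  fixes q :: "'b \<Rightarrow> 'a::idom"
  assumes "finite B" "\<And>b. b \<in> B \<Longrightarrow> prime_elem (q b)"
    and "\<And>b b'. b \<in> B \<Longrightarrow> b' \<in> B \<Longrightarrow> b \<noteq> b' \<Longrightarrow> \<not> q b dvd q b'"
    and "\<And>b. b \<in> B \<Longrightarrow> q b ^ e b dvd x"
  shows "(\<Prod>b\<in>B. q b ^ e b) dvd x"
  using assms
proof (induction B)
  case (insert b B)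
  let ?Y = "\<Prod>b\<in>B. q b ^ e b"
  have "?Y dvd x" using insert by blast
  then obtain z where z: "x = z * ?Y" by (metis dvdE mult.commute)
  have "\<not> q b dvd ?Y"
    using insert by (intro prime_elem_not_dvd_prod_power) auto
  moreover have "q b ^ e b dvd z * ?Y" using insert.prems(3)[of b] z by simp
  ultimately have "q b ^ e b dvd z"
    using prime_power_dvd_cancel insert.prems(1) by blast
  then show ?case using insert z by (simp add: mult_dvd_mono)
qed simp

text \<open>In \<open>p ^ k * y = g * f\<close> the power of \<open>p\<close> has to sit in
  \<open>g\<close>, from where it can be cancelled.\<close>

lemma dvd_prime_power_cancel:
  fixes f :: "'a::idom"
  assumes "prime_elem p" "\<not> p dvd f" "f dvd p ^ k * y"
  shows "f dvd y"
proof -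
  obtain g where g: "p ^ k * y = g * f" using assms(3) by (metis dvdE mult.commute)
  then have "p ^ k dvd g" by (metis assms(1,2) dvd_triv_left prime_power_dvd_cancel)
  then obtain h where "g = p ^ k * h" by (elim dvdE)
  with g have "y = h * f"
    using assms(1) by (simp add: mult.assoc prime_elem_not_zeroI)
  then show ?thesis by simp
qed

lemma dvd_prod_prime_powers_cancel:
  fixes f :: "'a::idom"
  assumes "\<And>b. b \<in> B \<Longrightarrow> prime_elem (q b)" "\<And>b. b \<in> B \<Longrightarrow> \<not> q b dvd f"
    and "f dvd (\<Prod>b\<in>B. q b ^ e b) * y"
  shows "f dvd y"
  using assms
proof (induction B arbitrary: y rule: infinite_finite_induct)
  case (insert b B)
  have "f dvd q b ^ e b * ((\<Prod>b\<in>B. q b ^ e b) * y)"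
    using insert.prems(3) insert.hyps by (simp add: mult.assoc)
  then have "f dvd (\<Prod>b\<in>B. q b ^ e b) * y"
    by (rule dvd_prime_power_cancel[rotated 2]) (use insert.prems in auto)
  then show ?case by (rule insert.IH[rotated 2]) (use insert.prems in auto)
qed simp_all

text \<open>The matrices used below have one exceptional diagonal entry, at
  \<open>p\<close>.\<close>

lemma prod_if_eq_power:
  fixes p :: "'n::finite"
  shows "(\<Prod>i\<in>UNIV. if i = p then a else b) = a * b ^ (CARD('n) - 1)"
proof -
  have "(\<Prod>i\<in>UNIV - {p}. if i = p then a else b) = (\<Prod>i\<in>UNIV - {p}. b)"
    by (rule prod.cong) auto
  then show ?thesis by (simp add: prod.remove[of _ p] card_Diff_singleton)
qed

section \<open>Determinants\<close>

text \<open>By injectivity a permutation fixing every index except \<open>p\<close> also fixes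
  \<open>p\<close>. So any other permutation than the identity moves some index different from
  \<open>p\<close> and picks up a zero entry.\<close>

lemma det_single_row:
  fixes A :: "'a::comm_ring_1^'n^'n"
  assumes "\<And>i j. i \<noteq> p \<Longrightarrow> i \<noteq> j \<Longrightarrow> A $ i $ j = 0"
  shows "det A = (\<Prod>i\<in>UNIV. A $ i $ i)"
proof -
  have "(\<Prod>i\<in>UNIV. A $ i $ \<pi> i) = 0" if "\<pi> permutes UNIV" "\<pi> \<noteq> id" for \<pi>
  proof -
    have "\<exists>i. i \<noteq> p \<and> \<pi> i \<noteq> i"
    proof (rule ccontr)
      assume "\<not> ?thesis"
      then have *: "\<pi> i = i" if "i \<noteq> p" for i using that by blast
      have "\<pi> p = p"
        using *[of "\<pi> p"] permutes_inj[OF \<open>\<pi> permutes UNIV\<close>] by (metis injD)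
      with * have "\<pi> = id" by (metis eq_id_iff)
      with \<open>\<pi> \<noteq> id\<close> show False ..
    qed
    then have "\<exists>i. A $ i $ \<pi> i = 0" using assms by metis
    then show ?thesis by (meson UNIV_I finite prod_zero)
  qed
  then have "(\<Sum>\<pi>\<in>{id}. of_int (sign \<pi>) * (\<Prod>i\<in>UNIV. A $ i $ \<pi> i)) = det A"
    unfolding det_def by (intro sum.mono_neutral_left) (auto simp: permutes_id finite_permutations)
  then show ?thesis by (simp add: sign_id)
qed

lemma det_single_column:
  fixes A :: "'a::comm_ring_1^'n^'n"
  assumes "\<And>i j. j \<noteq> p \<Longrightarrow> i \<noteq> j \<Longrightarrow> A $ i $ j = 0"
  shows "det A = (\<Prod>i\<in>UNIV. A $ i $ i)"
  using det_single_row[of p "transpose A"] assms unfolding det_transpose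
  by (simp add: transpose_def)

text \<open>Multilinearity: pull \<open>d i\<close> out of row \<open>i\<close>.\<close>

lemma prod_dvd_det:
  fixes A :: "'a::comm_ring_1^'n^'n"
  assumes "\<And>i j. d i dvd A $ i $ j"
  shows "(\<Prod>i\<in>UNIV. d i) dvd det A"
proof -
  obtain B where "\<And>i j. A $ i $ j = d i * B i j"
    using assms unfolding dvd_def by metis
  then have "A = (\<chi> i. d i *s (\<chi> j. B i j))"
    by (simp add: vec_eq_iff)
  then show ?thesis using det_rows_mul[of d "\<lambda>i. \<chi> j. B i j"] by simp
qed

text \<open>A determinant is a signed sum of products of entries. Applied to \<open>to_fract\<close>
  and to \<open>pconst\<close>.\<close>

lemma det_hom:
  fixes A :: "'a::comm_ring_1^'n^'n" and h :: "'a \<Rightarrow> 'b::comm_ring_1"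
  assumes "\<And>a b. h (a + b) = h a + h b" "\<And>a b. h (a * b) = h a * h b" "h 1 = 1"
  shows "det (\<chi> i j. h (A $ i $ j)) = h (det A)"
proof -
  have h0: "h 0 = 0" using assms(1)[of 0 0] by simp
  then have neg: "h (- a) = - h a" for a using assms(1)[of a "- a"] by (simp add: add_eq_0_iff)
  have sgn: "h (of_int (sign \<pi>)) = of_int (sign \<pi>)" for \<pi> :: "'n \<Rightarrow> 'n"
    by (simp add: sign_def assms(3) neg)
  have sum: "h (sum f T) = (\<Sum>t\<in>T. h (f t))" for f and T :: "('n \<Rightarrow> 'n) set"
    by (induction T rule: infinite_finite_induct) (simp_all add: assms(1) h0)
  have prod: "h (prod f T) = (\<Prod>t\<in>T. h (f t))" for f and T :: "'n set"
    by (induction T rule: infinite_finite_induct) (simp_all add: assms(2,3))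
  show ?thesis by (simp add: det_def sum prod sgn assms(2))
qed

lemma det_to_fract:
  fixes A :: "'a::idom^'n^'n"
  shows "det (\<chi> i j. to_fract (A $ i $ j)) = to_fract (det A)"
  by (rule det_hom) simp_all

type_synonym 'n C_mat = "((complex, 'n) vec, 'n) vec"
type_synonym 'n S_mat = "(('n S, 'n) vec, 'n) vec"

definition const_mat :: "'n C_mat \<Rightarrow> ('n::finite) S_mat" where
  "const_mat A = (\<chi> i j. pconst (A $ i $ j))"

lemma det_const_mat:
  fixes A :: "('n::{finite,linorder}) C_mat"
  shows "det (const_mat A) = pconst (det A)"
  unfolding const_mat_def by (rule det_hom) (simp_all add: pconst_add pconst_mult)

lemma const_mat_mult:
  fixes A B :: "('n::{finite,linorder}) C_mat"
  shows "const_mat (A ** B) = const_mat A ** const_mat B"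
  by (simp add: const_mat_def matrix_matrix_mult_def pconst_sum pconst_mult)

lemma const_mat_1: "const_mat (mat 1) = mat 1"
  by (simp add: const_mat_def mat_def vec_eq_iff)

text \<open>Nonzero constants are units. Hence multiplying a matrix by an invertible constant matrix
  does not change which polynomials divide its determinant.\<close>

lemma dvd_pconst_mult_iff:
  fixes x :: "('n::{finite,linorder}) S"
  assumes "k \<noteq> 0"
  shows "x dvd pconst k * y \<longleftrightarrow> x dvd y"
proof
  assume "x dvd pconst k * y"
  then have "x dvd pconst (1 / k) * (pconst k * y)" by simp
  then show "x dvd y" using assms by (simp flip: mult.assoc pconst_mult)
qed simp

definition of_cols :: "('n \<Rightarrow> 'a^'n) \<Rightarrow> 'a^'n^'n" where
  "of_cols v = (\<chi> i j. v j $ i)"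

lemma matrix_mult_of_cols_nth: "(A ** of_cols v) $ i $ j = (A *v v j) $ i"
  by (simp add: of_cols_def matrix_matrix_mult_def matrix_vector_mult_def)

lemma matrix_vector_mult_scale:
  fixes v :: "('a::comm_ring_1, 'n::finite) vec"
  shows "A *v (f *s v) = f *s (A *v v)"
  by (simp add: vec_eq_iff matrix_vector_mult_def sum_distrib_left mult.left_commute)

lemma dvd_matrix_vector_mult:
  fixes v :: "('a::comm_ring_1, 'n::finite) vec"
  shows "(\<And>i. a dvd v $ i) \<Longrightarrow> a dvd (A *v v) $ i"
  unfolding matrix_vector_mult_def by (auto intro!: dvd_sum dvd_mult)

lemma matrix_mult_of_cols: "A ** of_cols v = of_cols (\<lambda>j. A *v v j)"
  by (simp add: of_cols_def matrix_matrix_mult_def matrix_vector_mult_def)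

section \<open>Saito's criterion with cleared denominators\<close>

text \<open>
  \<open>cleared\<close> consists of the \<open>\<eta>\<close> over \<open>S\<close> with \<open>\<eta> / QN\<close> in the generalized logarithmic module;
  \<open>P\<close> and \<open>N\<close> play the roles of \<open>\<A>\<^sub>+\<close> and \<open>\<A>\<^sub>-\<close>, \<open>e\<close> that of \<open>\<bar>m\<bar>\<close>.  \<open>G\<close> is the Gram matrix of
  the inner product, so its inverse \<open>G'\<close> turns derivations into forms.
\<close>

locale linear_form_family =
  fixes c :: "'h \<Rightarrow> 'n::{finite,linorder} \<Rightarrow> complex"
    and P N :: "'h set" and e :: "'h \<Rightarrow> nat" and G G' :: "'n C_mat"
  assumes finite: "finite P" "finite N" and disjoint: "P \<inter> N = {}"
    and nonzero: "H \<in> P \<union> N \<Longrightarrow> \<exists>i. c H i \<noteq> 0"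
    and not_dvd: "H \<in> P \<union> N \<Longrightarrow> H' \<in> P \<union> N \<Longrightarrow> H \<noteq> H' \<Longrightarrow> \<not> lin (c H) dvd lin (c H')"
    and inverse: "G' ** G = mat 1"
begin

abbreviation L :: "'h \<Rightarrow> 'n S" where "L H \<equiv> lin (c H)"

definition QP :: "'n S" where "QP = (\<Prod>H\<in>P. L H ^ e H)"

definition QN :: "'n S" where "QN = (\<Prod>H\<in>N. L H ^ e H)"

text \<open>The determinant \<open>QP / QN\<close> of the criterion after multiplying each of the
  \<open>CARD('n)\<close> columns by \<open>QN\<close>; one factor \<open>QN\<close> cancels against
  the denominator.\<close>

definition target :: "'n S" where "target = QP * QN ^ (CARD('n) - 1)"

text \<open>The sum is the value of the derivation \<open>\<eta>\<close> at
  \<open>L H\<close>.\<close>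

definition der_cond :: "'h \<Rightarrow> 'n S_vec \<Rightarrow> bool" where
  "der_cond H \<eta> \<longleftrightarrow> L H ^ e H dvd (\<Sum>i\<in>UNIV. pconst (c H i) * \<eta> $ i)"

text \<open>The differences are the numerators over \<open>QN\<close> of the coefficients of the
  2-form obtained by wedging the differential of \<open>L H\<close> with
  \<open>\<zeta> / QN\<close>; the pole along \<open>H\<close> disappears when they absorb the
  factor \<open>L H ^ e H\<close> of \<open>QN\<close>.\<close>

definition form_cond :: "'h \<Rightarrow> 'n S_vec \<Rightarrow> bool" where
  "form_cond H \<zeta> \<longleftrightarrow> (\<forall>i l. L H ^ e H dvd pconst (c H i) * \<zeta> $ l - pconst (c H l) * \<zeta> $ i)"

definition cleared :: "'n S_vec set" where
  "cleared = {\<eta>. (\<forall>H\<in>P. der_cond H \<eta>) \<and> (\<forall>H\<in>N. form_cond H (const_mat G' *v \<eta>))}"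

lemma prime_L: "H \<in> P \<union> N \<Longrightarrow> prime_elem (L H)"
  using nonzero prime_elem_lin by metis

lemma QP_nonzero: "QP \<noteq> 0" and QN_nonzero: "QN \<noteq> 0"
  using prime_L finite by (auto simp: QP_def QN_def prime_elem_not_zeroI)

lemma target_nonzero: "target \<noteq> 0"
  by (simp add: target_def QP_nonzero QN_nonzero)

lemma det_G: "det G \<noteq> 0"
  using inverse by (metis det_I det_mul mult_zero_right zero_neq_one)

lemma const_mat_inverse: "const_mat G' *v (const_mat G *v \<zeta>) = \<zeta>"
  by (simp add: matrix_vector_mul_assoc inverse const_mat_1 flip: const_mat_mult)

lemma der_condI: "(\<And>i. L H ^ e H dvd \<eta> $ i) \<Longrightarrow> der_cond H \<eta>"
  unfolding der_cond_def by (intro dvd_sum dvd_mult)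

lemma form_condI: "(\<And>i. L H ^ e H dvd \<zeta> $ i) \<Longrightarrow> form_cond H \<zeta>"
  unfolding form_cond_def by (intro allI dvd_diff dvd_mult)

section \<open>Closure of \<open>cleared\<close> under \<open>S\<close>-linear combinations\<close>

lemma cleared_add: "\<eta> \<in> cleared \<Longrightarrow> \<eta>' \<in> cleared \<Longrightarrow> \<eta> + \<eta>' \<in> cleared"
proof -
  have "der_cond H (\<eta> + \<eta>')" if "der_cond H \<eta>" "der_cond H \<eta>'" for H \<eta> \<eta>'
    using dvd_add[OF that[unfolded der_cond_def]]
    by (simp add: der_cond_def distrib_left sum.distrib)
  moreover have "form_cond H (\<zeta> + \<zeta>')" if "form_cond H \<zeta>" "form_cond H \<zeta>'" for H \<zeta> \<zeta>'
    unfolding form_cond_def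
  proof (intro allI)
    fix i l
    have "L H ^ e H dvd (pconst (c H i) * \<zeta> $ l - pconst (c H l) * \<zeta> $ i)
        + (pconst (c H i) * \<zeta>' $ l - pconst (c H l) * \<zeta>' $ i)"
      using that by (intro dvd_add) (auto simp: form_cond_def)
    then show "L H ^ e H dvd pconst (c H i) * (\<zeta> + \<zeta>') $ l - pconst (c H l) * (\<zeta> + \<zeta>') $ i"
      by (simp add: algebra_simps)
  qed
  ultimately show "\<eta> \<in> cleared \<Longrightarrow> \<eta>' \<in> cleared \<Longrightarrow> \<eta> + \<eta>' \<in> cleared"
    by (simp add: cleared_def matrix_vector_right_distrib)
qed

lemma cleared_scale: "\<eta> \<in> cleared \<Longrightarrow> f *s \<eta> \<in> cleared"
proof -
  have "der_cond H (f *s \<eta>)" if "der_cond H \<eta>" for H \<eta>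
    using dvd_mult[OF that[unfolded der_cond_def], of f]
    by (simp add: der_cond_def sum_distrib_left mult.left_commute)
  moreover have "form_cond H (f *s \<zeta>)" if "form_cond H \<zeta>" for H \<zeta>
    unfolding form_cond_def
  proof (intro allI)
    fix i l
    have "L H ^ e H dvd f * (pconst (c H i) * \<zeta> $ l - pconst (c H l) * \<zeta> $ i)"
      using that by (intro dvd_mult) (auto simp: form_cond_def)
    then show "L H ^ e H dvd pconst (c H i) * (f *s \<zeta>) $ l - pconst (c H l) * (f *s \<zeta>) $ i"
      by (simp add: algebra_simps)
  qed
  ultimately show "\<eta> \<in> cleared \<Longrightarrow> f *s \<eta> \<in> cleared"
    by (simp add: cleared_def matrix_vector_mult_scale)
qed

lemma cleared_0: "0 \<in> cleared"
  by (simp add: cleared_def der_condI form_condI)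

lemma cleared_sum: "(\<And>j. j \<in> J \<Longrightarrow> \<eta> j \<in> cleared) \<Longrightarrow> (\<Sum>j\<in>J. f j *s \<eta> j) \<in> cleared"
  by (induction J rule: infinite_finite_induct)
    (auto intro: cleared_add cleared_scale cleared_0)

section \<open>Divisibility of determinants by \<open>target\<close>\<close>

lemma der_power_dvd_det:
  assumes "H \<in> P" "\<And>j. \<eta> j \<in> cleared"
  shows "L H ^ e H dvd det (of_cols \<eta>)"
proof -
  obtain p where p: "c H p \<noteq> 0" using assms nonzero by blast
  \<comment> \<open>Multiplication by \<open>B\<close> replaces row \<open>p\<close> by the values
    of the \<open>\<eta> j\<close> at \<open>L H\<close> and keeps the other rows. Its determinant
    is the nonzero constant \<open>c H p\<close>.\<close>
  define B :: "'n C_mat" where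
    "B = (\<chi> i j. if i = p then c H j else if i = j then 1 else 0)"
  define d where "d i = (if i = p then L H ^ e H else 1)" for i
  have "det B = (\<Prod>i\<in>UNIV. B $ i $ i)"
    by (rule det_single_row[of p]) (simp add: B_def)
  also have "\<dots> = (\<Prod>i\<in>UNIV. if i = p then c H p else 1)"
    by (rule prod.cong) (auto simp: B_def)
  finally have detB: "det B = c H p" by (simp add: prod_if_eq_power)
  have "(const_mat B *v \<eta> j) $ p = (\<Sum>k\<in>UNIV. pconst (c H k) * \<eta> j $ k)" for j
    by (simp add: matrix_vector_mult_def const_mat_def B_def)
  then have "d i dvd (const_mat B ** of_cols \<eta>) $ i $ j" for i j
    using assms by (auto simp: d_def matrix_mult_of_cols_nth cleared_def der_cond_def)
  then have "(\<Prod>i\<in>UNIV. d i) dvd det (const_mat B ** of_cols \<eta>)"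
    by (rule prod_dvd_det)
  then show ?thesis
    using p by (simp add: d_def prod_if_eq_power det_mul det_const_mat detB dvd_pconst_mult_iff)
qed

lemma form_power_dvd_det:
  assumes "H \<in> N" "\<And>j. \<eta> j \<in> cleared"
  shows "(L H ^ e H) ^ (CARD('n) - 1) dvd det (of_cols \<eta>)"
proof -
  obtain p where p: "c H p \<noteq> 0" using assms nonzero by blast
  \<comment> \<open>Multiplication by \<open>B\<close> keeps row \<open>p\<close> and replaces every
    other row \<open>i\<close> by \<open>c H p\<close> times row \<open>i\<close> minus
    \<open>c H i\<close> times row \<open>p\<close>, which are the expressions in
    \<open>form_cond\<close>.\<close>
  define B :: "'n C_mat" where
    "B = (\<chi> i j. if i = p then if j = p then 1 else 0
       else (if j = i then c H p else 0) - (if j = p then c H i else 0))"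
  define d where "d i = (if i = p then 1 else L H ^ e H)" for i
  define \<zeta> where "\<zeta> j = const_mat G' *v \<eta> j" for j
  have "det B = (\<Prod>i\<in>UNIV. if i = p then 1 else c H p)"
    unfolding B_def by (subst det_single_column[of p]) (auto intro: prod.cong)
  then have detB: "det B \<noteq> 0" using p by (simp add: prod_if_eq_power)
  have "(const_mat B *v \<zeta> j) $ i = pconst (c H p) * \<zeta> j $ i - pconst (c H i) * \<zeta> j $ p"
    if "i \<noteq> p" for i j
  proof -
    have "(const_mat B *v \<zeta> j) $ i = (\<Sum>k\<in>UNIV. (if k = i then pconst (c H p) * \<zeta> j $ k else 0)
        - (if k = p then pconst (c H i) * \<zeta> j $ k else 0))"
      unfolding matrix_vector_mult_def const_mat_def B_def using that
      by (auto intro!: sum.cong simp: pconst_diff left_diff_distrib)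
    then show ?thesis by (simp add: sum_subtractf)
  qed
  then have "d i dvd (const_mat B ** of_cols \<zeta>) $ i $ j" for i j
    using assms by (auto simp: d_def matrix_mult_of_cols_nth cleared_def form_cond_def \<zeta>_def)
  then have "(\<Prod>i\<in>UNIV. d i) dvd det (const_mat B ** of_cols \<zeta>)"
    by (rule prod_dvd_det)
  then have "(L H ^ e H) ^ (CARD('n) - 1) dvd det (of_cols \<zeta>)"
    using detB by (simp add: d_def prod_if_eq_power det_mul det_const_mat dvd_pconst_mult_iff)
  \<comment> \<open>Passing from the forms \<open>\<zeta> j\<close> back to the
    \<open>\<eta> j\<close> costs only the nonzero constant \<open>det G'\<close>.\<close>
  moreover have "of_cols \<zeta> = const_mat G' ** of_cols \<eta>"
    by (simp add: matrix_mult_of_cols flip: \<zeta>_def)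
  moreover have "det G' \<noteq> 0"
    using inverse by (metis det_I det_mul mult_zero_left zero_neq_one)
  ultimately show ?thesis by (simp add: det_mul det_const_mat dvd_pconst_mult_iff)
qed

lemma target_dvd_det:
  assumes "\<And>j. \<eta> j \<in> cleared"
  shows "target dvd det (of_cols \<eta>)"
proof -
  \<comment> \<open>The exponent of \<open>L H\<close> in \<open>target\<close>.\<close>
  define k where "k H = (if H \<in> P then e H else e H * (CARD('n) - 1))" for H
  have "(\<Prod>H\<in>P \<union> N. L H ^ k H) dvd det (of_cols \<eta>)"
  proof (rule prod_prime_powers_dvd)
    show "L H ^ k H dvd det (of_cols \<eta>)" if "H \<in> P \<union> N" for H
      using that der_power_dvd_det[OF _ assms] form_power_dvd_det[OF _ assms]
      by (auto simp: k_def power_mult)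
  qed (simp add: finite, rule prime_L, assumption, rule not_dvd, assumption+)
  also have "(\<Prod>H\<in>P \<union> N. L H ^ k H) = (\<Prod>H\<in>P. L H ^ k H) * (\<Prod>H\<in>N. L H ^ k H)"
    using finite disjoint by (rule prod.union_disjoint)
  also have "(\<Prod>H\<in>P. L H ^ k H) = QP"
    by (simp add: QP_def k_def)
  also have "(\<Prod>H\<in>N. L H ^ k H) = QN ^ (CARD('n) - 1)"
    unfolding QN_def prod_power_distrib
    by (rule prod.cong) (use disjoint in \<open>auto simp: k_def power_mult\<close>)
  finally show ?thesis by (simp add: target_def)
qed

text \<open>Expressing the \<open>\<xi> j\<close> through the \<open>\<eta> j\<close> is a matrix
  factorization, and determinants are multiplicative.\<close>

lemma det_dvd_det_if_spanning:
  assumes "\<And>v. v \<in> cleared \<Longrightarrow> \<exists>f. v = (\<Sum>j\<in>UNIV. f j *s \<eta> j)" "\<And>j. \<xi> j \<in> cleared"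
  shows "det (of_cols \<eta>) dvd det (of_cols \<xi>)"
proof -
  have "\<forall>j. \<exists>f. \<xi> j = (\<Sum>k\<in>UNIV. f k *s \<eta> k)"
    using assms by blast
  then obtain F where F: "\<And>j. \<xi> j = (\<Sum>k\<in>UNIV. F j k *s \<eta> k)"
    by (auto dest!: choice)
  have "of_cols \<xi> = of_cols \<eta> ** (\<chi> k j. F j k)"
    by (simp add: of_cols_def matrix_matrix_mult_def F vec_eq_iff mult.commute)
  then show ?thesis by (simp add: det_mul)
qed

lemma L_power_dvd_QP: "H \<in> P \<Longrightarrow> L H ^ e H dvd QP"
  and L_power_dvd_QN: "H \<in> N \<Longrightarrow> L H ^ e H dvd QN"
  unfolding QP_def QN_def
  by (rule dvd_prodI[where f = "\<lambda>H. L H ^ e H"]; simp add: finite)+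

section \<open>Test families in \<open>cleared\<close> with known determinants\<close>

lemma ex_det_cleared:
  obtains \<xi> where "\<forall>j. \<xi> j \<in> cleared" "det (of_cols \<xi>) = QN * QP ^ (CARD('n) - 1) * target"
proof
  \<comment> \<open>A factor \<open>QP * QN\<close> on the coordinate vectors meets every condition
    at once, and only the primes \<open>L H\<close> divide the resulting cofactor of
    \<open>target\<close>.\<close>
  define \<xi> :: "'n \<Rightarrow> 'n S_vec" where "\<xi> j = (\<chi> i. if i = j then QP * QN else 0)" for j
  have "\<xi> j \<in> cleared" for j
    unfolding cleared_def
    by (auto simp: \<xi>_def L_power_dvd_QP L_power_dvd_QN intro!: der_condI form_condI dvd_matrix_vector_mult)
  then show "\<forall>j. \<xi> j \<in> cleared" ..
  have "det (of_cols \<xi>) = (QP * QN) ^ CARD('n)"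
    by (subst det_diagonal) (auto simp: \<xi>_def of_cols_def)
  also have "\<dots> = (QP * QN) * (QP * QN) ^ (CARD('n) - 1)"
    by (simp flip: power_Suc)
  finally show "det (of_cols \<xi>) = QN * QP ^ (CARD('n) - 1) * target"
    by (simp add: target_def power_mult_distrib mult_ac)
qed

text \<open>The vectors with \<open>j \<noteq> p\<close> are multiples of derivations that
  annihilate \<open>L H\<close>, so they meet the condition at \<open>H\<close> without a factor
  \<open>L H\<close>; \<open>R\<close> and \<open>QN\<close> take care of the other hyperplanes.
  Only the vector at \<open>p\<close> carries \<open>L H ^ e H\<close>, and \<open>target\<close>
  accounts for that power.\<close>

lemma ex_det_cleared_pos:
  assumes "H \<in> P"
  obtains \<xi> X where "\<forall>j. \<xi> j \<in> cleared" "det (of_cols \<xi>) = X * target" "\<not> L H dvd X"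
proof -
  obtain p where p: "c H p \<noteq> 0" using assms nonzero by blast
  define R where "R = (\<Prod>H\<in>P - {H}. L H ^ e H)"
  have QP: "QP = R * L H ^ e H"
    using assms finite by (simp add: QP_def R_def prod.remove[of _ H] mult.commute)
  have R: "L H' ^ e H' dvd R" if "H' \<in> P" "H' \<noteq> H" for H'
    unfolding R_def
    by (rule dvd_prodI[where f = "\<lambda>H. L H ^ e H"]) (use that finite in simp_all)
  define \<xi> :: "'n \<Rightarrow> 'n S_vec" where
    "\<xi> j = (\<chi> i. if j = p then if i = p then QP * QN else 0
       else R * QN * ((if i = j then pconst (c H p) else 0) - (if i = p then pconst (c H j) else 0)))" for j
  define X where "X = QN * (R * pconst (c H p)) ^ (CARD('n) - 1)"
  have sum: "(\<Sum>i\<in>UNIV. pconst (c H i) * \<xi> j $ i) = (if j = p then pconst (c H p) * (QP * QN) else 0)" for j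
  proof -
    have "(\<Sum>i\<in>UNIV. pconst (c H i) * \<xi> j $ i) = R * QN *
       (\<Sum>i\<in>UNIV. (if i = j then pconst (c H i) * pconst (c H p) else 0)
          - (if i = p then pconst (c H i) * pconst (c H j) else 0))" if "j \<noteq> p"
      unfolding sum_distrib_left using that
      by (intro sum.cong) (auto simp: \<xi>_def algebra_simps)
    then show ?thesis
      by (simp add: sum_subtractf mult.commute) (simp add: \<xi>_def if_distrib[of "(*) _"] cong: if_cong)
  qed
  have "\<xi> j \<in> cleared" for j
  proof -
    have "der_cond H' (\<xi> j)" if "H' \<in> P" for H'
    proof (cases "H' = H")
      case True
      then show ?thesis using L_power_dvd_QP[OF assms] by (simp add: der_cond_def sum)
    next
      case False
      with R[OF that] QP show ?thesis by (intro der_condI) (auto simp: \<xi>_def)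
    qed
    moreover have "form_cond H' (const_mat G' *v \<xi> j)" if "H' \<in> N" for H'
      using L_power_dvd_QN[OF that] by (intro form_condI dvd_matrix_vector_mult) (auto simp: \<xi>_def)
    ultimately show ?thesis by (simp add: cleared_def)
  qed
  moreover have "det (of_cols \<xi>) = X * target"
  proof -
    have "det (of_cols \<xi>) = (\<Prod>i\<in>UNIV. if i = p then QP * QN else R * QN * pconst (c H p))"
      by (subst det_single_row[of p]) (auto simp: \<xi>_def of_cols_def intro!: prod.cong)
    then show ?thesis
      by (simp add: prod_if_eq_power X_def target_def power_mult_distrib mult_ac)
  qed
  moreover have "\<not> L H dvd X"
  proof
    have prime: "prime_elem (L H)" using prime_L assms by blast
    have "\<not> L H dvd QN" "\<not> L H dvd R"
      unfolding QN_def R_def using assms disjoint not_dvd prime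
      by (intro prime_elem_not_dvd_prod_power; blast)+
    moreover have "\<not> L H dvd pconst (c H p)"
      using dvd_pconst_mult_iff[OF p, of "L H" 1] prime prime_elem_not_unit by auto
    moreover assume "L H dvd X"
    ultimately show False
      using prime prime_elem_dvd_multD prime_elem_dvd_power unfolding X_def by metis
  qed
  ultimately show thesis using that by blast
qed

text \<open>The form \<open>\<zeta> p\<close> is a multiple of the differential of
  \<open>L H\<close>, so its wedge with that differential vanishes and no factor \<open>L H\<close>
  is required. The other forms carry the full \<open>QN\<close>, matching the exponent
  \<open>CARD('n) - 1\<close> in \<open>target\<close>. The matrix \<open>G\<close> then turns the
  forms into derivations.\<close>

lemma ex_det_cleared_neg:
  assumes "H \<in> N"
  obtains \<xi> X where "\<forall>j. \<xi> j \<in> cleared" "det (of_cols \<xi>) = X * target" "\<not> L H dvd X"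
proof -
  obtain p where p: "c H p \<noteq> 0" using assms nonzero by blast
  define R where "R = (\<Prod>H\<in>N - {H}. L H ^ e H)"
  have QN: "QN = R * L H ^ e H"
    using assms finite by (simp add: QN_def R_def prod.remove[of _ H] mult.commute)
  have R: "L H' ^ e H' dvd R" if "H' \<in> N" "H' \<noteq> H" for H'
    unfolding R_def
    by (rule dvd_prodI[where f = "\<lambda>H. L H ^ e H"]) (use that finite in simp_all)
  define \<zeta> :: "'n \<Rightarrow> 'n S_vec" where
    "\<zeta> j = (\<chi> i. if j = p then QP * R * pconst (c H i) else if i = j then QP * QN else 0)" for j
  define \<xi> where "\<xi> j = const_mat G *v \<zeta> j" for j
  define X where "X = pconst (det G * c H p) * (R * QP ^ (CARD('n) - 1))"
  have "\<xi> j \<in> cleared" for j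
  proof -
    have "der_cond H' (\<xi> j)" if "H' \<in> P" for H'
      unfolding \<xi>_def using L_power_dvd_QP[OF that]
      by (intro der_condI dvd_matrix_vector_mult) (auto simp: \<zeta>_def)
    moreover have "form_cond H' (\<zeta> j)" if "H' \<in> N" for H'
    proof (cases "H' = H \<and> j = p")
      case True
      then show ?thesis by (simp add: form_cond_def \<zeta>_def mult_ac)
    next
      case False
      then show ?thesis
        using R[OF that] L_power_dvd_QN[OF that] by (intro form_condI) (auto simp: \<zeta>_def)
    qed
    ultimately show ?thesis by (simp add: cleared_def \<xi>_def const_mat_inverse)
  qed
  moreover have "det (of_cols \<xi>) = X * target"
  proof -
    have "det (of_cols \<zeta>) = (\<Prod>i\<in>UNIV. if i = p then QP * R * pconst (c H p) else QP * QN)"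
      by (subst det_single_column[of p]) (auto simp: \<zeta>_def of_cols_def intro!: prod.cong)
    moreover have "of_cols \<xi> = const_mat G ** of_cols \<zeta>"
      by (simp add: matrix_mult_of_cols flip: \<xi>_def)
    ultimately show ?thesis
      by (simp add: det_mul det_const_mat prod_if_eq_power X_def target_def power_mult_distrib pconst_mult mult_ac)
  qed
  moreover have "\<not> L H dvd X"
  proof
    have prime: "prime_elem (L H)" using prime_L assms by blast
    have "\<not> L H dvd QP" "\<not> L H dvd R"
      unfolding QP_def R_def using assms disjoint not_dvd prime
      by (intro prime_elem_not_dvd_prod_power; blast)+
    moreover assume "L H dvd X"
    then have "L H dvd R * QP ^ (CARD('n) - 1)"
      using p det_G by (simp add: X_def dvd_pconst_mult_iff)
    ultimately show False
      using prime prime_elem_dvd_multD prime_elem_dvd_power by metis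
  qed
  ultimately show thesis using that by blast
qed

section \<open>Spanning families of \<open>cleared\<close> and their determinants\<close>

lemma det_eq_target_if_spanning:
  assumes "\<And>j. \<eta> j \<in> cleared"
    and spanning: "\<And>v. v \<in> cleared \<Longrightarrow> \<exists>f. v = (\<Sum>j\<in>UNIV. f j *s \<eta> j)"
  obtains k where "k \<noteq> 0" "det (of_cols \<eta>) = pconst k * target"
proof -
  obtain f where "det (of_cols \<eta>) = target * f"
    using target_dvd_det[of \<eta>, OF assms(1)] by (elim dvdE)
  then have f: "det (of_cols \<eta>) = f * target" by (simp add: mult.commute)
  \<comment> \<open>By spanning, \<open>f * target\<close> divides the determinant of every test
    family; cancel \<open>target\<close>.\<close>
  have dvd: "f dvd X" if "\<forall>j. \<xi> j \<in> cleared" "det (of_cols \<xi>) = X * target" for \<xi> X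
  proof -
    have "f * target dvd X * target"
      using det_dvd_det_if_spanning[of \<eta> \<xi>, OF spanning that(1)[rule_format]] unfolding f that(2) .
    then show ?thesis using target_nonzero by simp
  qed
  have not_L: "\<not> L H dvd f" if "H \<in> P \<union> N" for H
    using that
  proof
    assume "H \<in> P"
    then obtain \<xi> X where "\<forall>j. \<xi> j \<in> cleared" "det (of_cols \<xi>) = X * target" "\<not> L H dvd X"
      by (rule ex_det_cleared_pos)
    then show ?thesis using dvd[of \<xi> X] dvd_trans[of "L H" f X] by blast
  next
    assume "H \<in> N"
    then obtain \<xi> X where "\<forall>j. \<xi> j \<in> cleared" "det (of_cols \<xi>) = X * target" "\<not> L H dvd X"
      by (rule ex_det_cleared_neg)
    then show ?thesis using dvd[of \<xi> X] dvd_trans[of "L H" f X] by blast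
  qed
  obtain \<xi> where "\<forall>j. \<xi> j \<in> cleared" "det (of_cols \<xi>) = QN * QP ^ (CARD('n) - 1) * target"
    by (rule ex_det_cleared)
  then have "f dvd QN * QP ^ (CARD('n) - 1)"
    by (rule dvd)
  \<comment> \<open>The trailing factor 1 is the cofactor that remains when all powers of the
    \<open>L H\<close>, none of which divides \<open>f\<close>, have been stripped off.\<close>
  also have "QN * QP ^ (CARD('n) - 1) = (\<Prod>H\<in>N. L H ^ e H) * ((\<Prod>H\<in>P. L H ^ (e H * (CARD('n) - 1))) * 1)"
    by (simp add: QN_def QP_def power_mult flip: prod_power_distrib)
  finally have "f dvd (\<Prod>H\<in>P. L H ^ (e H * (CARD('n) - 1))) * 1"
    by (rule dvd_prod_prime_powers_cancel[rotated 2]) (simp_all add: prime_L not_L)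
  then have "f dvd 1"
    by (rule dvd_prod_prime_powers_cancel[rotated 2]) (simp_all add: prime_L not_L)
  then obtain k where "k \<noteq> 0" "f = pconst k" by (rule unit_imp_pconst)
  with f that show thesis by blast
qed

text \<open>In Cramer's rule the numerators are determinants with one column replaced by
  \<open>v\<close>. All columns still lie in \<open>cleared\<close>, so \<open>target\<close>
  divides them, and hence so does \<open>det (of_cols \<eta>)\<close>.\<close>

lemma spanning_if_det_eq_target:
  assumes "\<And>j. \<eta> j \<in> cleared" "k \<noteq> 0" "det (of_cols \<eta>) = pconst k * target"
    and "v \<in> cleared"
  shows "\<exists>f. v = (\<Sum>j\<in>UNIV. f j *s \<eta> j)"
proof -
  \<comment> \<open>Cramer's rule is applied over the fraction field; the resulting coefficients
    come from \<open>S\<close>, so the identity descends.\<close>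
  let ?fr = "\<lambda>A. \<chi> i j. to_fract (A $ i $ j)"
  have nz: "det (?fr (of_cols \<eta>)) \<noteq> 0"
    unfolding det_to_fract using assms(2,3) target_nonzero by simp
  have "\<exists>f. det (of_cols (\<eta>(j := v))) = f * det (of_cols \<eta>)" for j
  proof -
    have "target dvd det (of_cols (\<eta>(j := v)))"
      using assms(1,4) by (intro target_dvd_det) auto
    then obtain g where "det (of_cols (\<eta>(j := v))) = target * g" by (elim dvdE)
    also have "\<dots> = pconst (1 / k) * pconst k * (target * g)"
      using assms(2) by (simp flip: pconst_mult)
    also have "\<dots> = pconst (1 / k) * g * det (of_cols \<eta>)"
      unfolding assms(3) by (simp only: mult_ac)
    finally show ?thesis by blast
  qed
  then have "\<forall>j. \<exists>f. det (of_cols (\<eta>(j := v))) = f * det (of_cols \<eta>)" ..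
  then obtain f where f: "\<And>j. det (of_cols (\<eta>(j := v))) = f j * det (of_cols \<eta>)"
    by (auto dest!: choice)
  have numerator: "det (\<chi> i l. if l = j then (\<chi> i. to_fract (v $ i)) $ i else ?fr (of_cols \<eta>) $ i $ l)
      = to_fract (f j) * det (?fr (of_cols \<eta>))" for j
  proof -
    have "(\<chi> i l. if l = j then (\<chi> i. to_fract (v $ i)) $ i else ?fr (of_cols \<eta>) $ i $ l)
        = ?fr (of_cols (\<eta>(j := v)))"
      by (simp add: of_cols_def vec_eq_iff)
    then show ?thesis by (simp only: det_to_fract f to_fract_mult)
  qed
  have "?fr (of_cols \<eta>) *v (\<chi> j. to_fract (f j)) = (\<chi> i. to_fract (v $ i))"
    unfolding cramer[OF nz] numerator using nz by simp
  then have "to_fract (\<Sum>j\<in>UNIV. \<eta> j $ i * f j) = to_fract (v $ i)" for i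
    by (simp add: matrix_vector_mult_def vec_eq_iff of_cols_def)
  then have "(\<Sum>j\<in>UNIV. \<eta> j $ i * f j) = v $ i" for i
    by (simp only: to_fract_eq_iff)
  then have "v = (\<Sum>j\<in>UNIV. f j *s \<eta> j)"
    by (simp add: vec_eq_iff mult.commute)
  then show ?thesis by blast
qed

text \<open>The matrix is invertible over the fraction field, so it kills no nonzero coefficient
  vector.\<close>

lemma independent_if_det_nonzero:
  fixes \<eta> :: "'n \<Rightarrow> 'n S_vec"
  assumes "det (of_cols \<eta>) \<noteq> 0" "(\<Sum>j\<in>UNIV. f j *s \<eta> j) = 0"
  shows "f j = 0"
proof -
  let ?A = "\<chi> i j. to_fract (of_cols \<eta> $ i $ j)" and ?x = "\<chi> j. to_fract (f j)"
  have "(?A *v ?x) $ i = to_fract ((\<Sum>j\<in>UNIV. f j *s \<eta> j) $ i)" for i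
    by (simp add: matrix_vector_mult_def of_cols_def mult.commute)
  then have Ax: "?A *v ?x = 0"
    unfolding assms(2) by (simp add: vec_eq_iff)
  have "invertible ?A"
    using assms(1) by (simp only: invertible_det_nz det_to_fract to_fract_eq_0_iff not_False_eq_True)
  then obtain B where "B ** ?A = mat 1"
    by (auto simp: invertible_def)
  then have "?x = B *v (?A *v ?x)"
    by (simp only: matrix_vector_mul_assoc matrix_vector_mul_lid)
  then have "?x = 0"
    by (simp only: Ax matrix_vector_mult_0_right)
  then show ?thesis by (simp add: vec_eq_iff)
qed

end

section \<open>Bases over the polynomial ring\<close>

text \<open>Passes from the set \<open>range \<theta>\<close> to the indexed family. Injectivity is
  implied by independence of the family: if \<open>\<theta> k = \<theta> l\<close> with
  \<open>k \<noteq> l\<close>, the coefficients 1 at \<open>k\<close> and -1 at \<open>l\<close>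
  give a relation.\<close>

lemma is_S_basis_iff:
  fixes \<theta> :: "'n::{finite,linorder} \<Rightarrow> 'n K_vec"
  shows "is_S_basis \<theta> M \<longleftrightarrow>
    (\<forall>f. (\<Sum>j\<in>UNIV. S_scale (f j) (\<theta> j)) = 0 \<longrightarrow> (\<forall>j. f j = 0)) \<and>
    range (\<lambda>f. \<Sum>j\<in>UNIV. S_scale (f j) (\<theta> j)) = M"
    (is "_ \<longleftrightarrow> ?indep \<and> ?comb = M")
proof -
  interpret module S_scale by (rule module_S_scale)
  have sum_range: "(\<Sum>v\<in>range \<theta>. S_scale (u v) v) = (\<Sum>j\<in>UNIV. S_scale (u (\<theta> j)) (\<theta> j))"
    if "inj \<theta>" for u
    using that by (simp add: sum.reindex)
  have ex_fun: "\<exists>u. f = (\<lambda>j. u (\<theta> j))" if "inj \<theta>" for f :: "'n \<Rightarrow> 'n S"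
    using that by (intro exI[of _ "f \<circ> inv \<theta>"]) simp
  have span: "span (range \<theta>) = ?comb" if inj_\<theta>: "inj \<theta>"
  proof -
    have "span (range \<theta>) = range (\<lambda>u. \<Sum>j\<in>UNIV. S_scale (u (\<theta> j)) (\<theta> j))"
      by (simp add: span_finite sum_range[OF inj_\<theta>])
    also have "\<dots> = ?comb"
    proof (intro equalityI image_subsetI)
      show "(\<Sum>j\<in>UNIV. S_scale (u (\<theta> j)) (\<theta> j)) \<in> ?comb" for u
        by (rule range_eqI[of _ _ "\<lambda>j. u (\<theta> j)"]) (rule refl)
      fix f :: "'n \<Rightarrow> 'n S"
      obtain u where "f = (\<lambda>j. u (\<theta> j))" using ex_fun[OF inj_\<theta>, of f] ..
      then show "(\<Sum>j\<in>UNIV. S_scale (f j) (\<theta> j)) \<in> range (\<lambda>u. \<Sum>j\<in>UNIV. S_scale (u (\<theta> j)) (\<theta> j))"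
        by simp
    qed
    finally show ?thesis .
  qed
  have indep: "\<not> dependent (range \<theta>) \<longleftrightarrow> ?indep" if inj_\<theta>: "inj \<theta>"
  proof -
    have "\<not> dependent (range \<theta>) \<longleftrightarrow>
        (\<forall>u. (\<Sum>j\<in>UNIV. S_scale (u (\<theta> j)) (\<theta> j)) = 0 \<longrightarrow> (\<forall>j. u (\<theta> j) = 0))"
      by (auto simp: dependent_finite sum_range[OF inj_\<theta>])
    also have "\<dots> \<longleftrightarrow> ?indep"
    proof
      assume *: "\<forall>u. (\<Sum>j\<in>UNIV. S_scale (u (\<theta> j)) (\<theta> j)) = 0 \<longrightarrow> (\<forall>j. u (\<theta> j) = 0)"
      show ?indep
      proof
        fix f :: "'n \<Rightarrow> 'n S"
        obtain u where "f = (\<lambda>j. u (\<theta> j))" using ex_fun[OF inj_\<theta>, of f] ..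
        then show "(\<Sum>j\<in>UNIV. S_scale (f j) (\<theta> j)) = 0 \<longrightarrow> (\<forall>j. f j = 0)"
          using * by simp
      qed
    next
      assume *: ?indep
      show "\<forall>u. (\<Sum>j\<in>UNIV. S_scale (u (\<theta> j)) (\<theta> j)) = 0 \<longrightarrow> (\<forall>j. u (\<theta> j) = 0)"
      proof
        show "(\<Sum>j\<in>UNIV. S_scale (u (\<theta> j)) (\<theta> j)) = 0 \<longrightarrow> (\<forall>j. u (\<theta> j) = 0)" for u
          by (rule *[THEN spec, of "\<lambda>j. u (\<theta> j)"])
      qed
    qed
    finally show ?thesis .
  qed
  have inj: "inj \<theta>" if ?indep
  proof (rule injI)
    fix k l
    assume kl: "\<theta> k = \<theta> l"
    show "k = l"
    proof (rule ccontr)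
      assume "k \<noteq> l"
      define f :: "'n \<Rightarrow> 'n S" where "f j = (if j = k then 1 else 0) - (if j = l then 1 else 0)" for j
      have "S_scale (f j) (\<theta> j) = (if j = k then \<theta> j else 0) - (if j = l then \<theta> j else 0)" for j
        by (simp add: f_def scale_left_diff_distrib)
      then have "(\<Sum>j\<in>UNIV. S_scale (f j) (\<theta> j)) = 0"
        using kl by (simp add: sum_subtractf)
      then have "f k = 0" using that[rule_format, of f k] by simp
      with \<open>k \<noteq> l\<close> show False by (simp add: f_def)
    qed
  qed
  show ?thesis
  proof (cases "inj \<theta>")
    case True
    then show ?thesis by (simp only: is_S_basis_def span indep simp_thms)
  next
    case False
    then have "\<not> ?indep" using inj by (rule contrapos_nn)
    with False show ?thesis by (simp only: is_S_basis_def simp_thms)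
  qed
qed

section \<open>Denominators\<close>

lemma to_fract_power: "to_fract (a ^ k) = to_fract a ^ k"
  by (induction k) simp_all

text \<open>Clearing denominators gives \<open>y * q = p * (a ^ k * r)\<close> with \<open>q\<close>
  not divisible by \<open>a\<close>, so \<open>a ^ k\<close> must divide \<open>y\<close>.
  Conversely, cancelling \<open>a ^ k\<close> leaves the denominator \<open>r\<close>.\<close>

lemma regular_along_fract_iff:
  fixes a :: "('n::{finite,linorder}) S"
  assumes "prime_elem a" "\<not> a dvd r"
  shows "regular_along a (to_fract y / to_fract (a ^ k * r)) \<longleftrightarrow> a ^ k dvd y"
proof
  assume "regular_along a (to_fract y / to_fract (a ^ k * r))"
  then obtain p q where q: "\<not> a dvd q"
    and pq: "to_fract y / to_fract (a ^ k * r) = to_fract p / to_fract q"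
    by (auto simp: regular_along_def)
  have nz: "a ^ k * r \<noteq> 0"
    using assms by (auto simp: prime_elem_not_zeroI)
  from q have "q \<noteq> 0" by auto
  with pq nz have "to_fract y * to_fract q = to_fract p * to_fract (a ^ k * r)"
    by (simp only: frac_eq_eq to_fract_eq_0_iff not_False_eq_True)
  then have "y * q = p * (a ^ k * r)"
    by (simp only: to_fract_mult[symmetric] to_fract_eq_iff)
  then have "a ^ k dvd y * q" by simp
  then show "a ^ k dvd y"
    using assms(1) q by (rule prime_power_dvd_cancel[rotated 2])
next
  assume "a ^ k dvd y"
  then obtain z where z: "y = a ^ k * z" by (elim dvdE)
  have "to_fract y / to_fract (a ^ k * r) = to_fract z / to_fract r"
    using prime_elem_not_zeroI[OF assms(1)] by (simp add: z)
  with assms(2) show "regular_along a (to_fract y / to_fract (a ^ k * r))"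
    unfolding regular_along_def by blast
qed

definition over :: "'n S \<Rightarrow> 'n S_vec \<Rightarrow> ('n::{finite,linorder}) K_vec" where
  "over q \<eta> = (1 / to_fract q) *s vec_to_fract \<eta>"

lemma over_nth: "over q \<eta> $ i = to_fract (\<eta> $ i) / to_fract q"
  by (simp add: over_def vec_to_fract_def)

lemma over_eq_iff: "q \<noteq> 0 \<Longrightarrow> over q \<eta> = over q \<eta>' \<longleftrightarrow> \<eta> = \<eta>'"
  by (simp add: vec_eq_iff over_nth)

lemma over_sum: "over q (\<Sum>j\<in>J. f j *s \<eta> j) = (\<Sum>j\<in>J. S_scale (f j) (over q (\<eta> j)))"
  by (simp add: vec_eq_iff over_nth S_scale_def sum_divide_distrib)

lemma det_coeff_matrix_over:
  fixes \<eta> :: "'n::{finite,linorder} \<Rightarrow> 'n S_vec"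
  shows "det (coeff_matrix (\<lambda>j. over q (\<eta> j))) = to_fract (det (of_cols \<eta>)) / to_fract q ^ CARD('n)"
proof -
  have "der_apply_fract v (pvar i) = v $ i" for v :: "'n K_vec" and i
    by (simp add: der_apply_fract_def partial_pvar if_distrib[of to_fract] if_distrib[of "(*) _"] cong: if_cong)
  then have "coeff_matrix (\<lambda>j. over q (\<eta> j))
      = (\<chi> i. (1 / to_fract q) *s (\<chi> j. to_fract (of_cols \<eta> $ i $ j)))"
    by (simp add: coeff_matrix_def over_nth of_cols_def vec_eq_iff)
  then show ?thesis
    using det_rows_mul[of "\<lambda>i. 1 / to_fract q" "\<lambda>i. \<chi> j. to_fract (of_cols \<eta> $ i $ j)"]
    by (simp add: det_to_fract power_divide)
qed

text \<open>In coordinates the isomorphism is multiplication by the Gram matrix. Symmetry of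
  \<open>I\<close> is used because \<open>form_pairing\<close> sums over the first index of that
  matrix.\<close>

lemma form_to_der_over:
  assumes "\<And>i j. I (x i) (x j) = I (x j) (x i)"
  shows "form_to_der x I (over q \<zeta>)
    = over q (const_mat (\<chi> i j. complex_of_real (I (x i) (x j))) *v \<zeta>)"
proof -
  let ?c = "\<lambda>i j. pconst (complex_of_real (I (x i) (x j)))"
  have "form_to_der x I (over q \<zeta>) $ i = to_fract (\<Sum>k\<in>UNIV. ?c i k * \<zeta> $ k) / to_fract q" for i
  proof -
    have "(\<Sum>j\<in>UNIV. over q \<zeta> $ k * to_fract (partial j (pvar i)) * to_fract (?c k j))
        = to_fract (?c i k * \<zeta> $ k) / to_fract q" for k
    proof -
      have "(\<Sum>j\<in>UNIV. over q \<zeta> $ k * to_fract (partial j (pvar i)) * to_fract (?c k j))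
          = (\<Sum>j\<in>UNIV. if j = i then over q \<zeta> $ k * to_fract (?c k j) else 0)"
        by (rule sum.cong) (auto simp: partial_pvar)
      then show ?thesis by (simp add: over_nth assms[of k i] mult.commute)
    qed
    then show ?thesis
      by (simp add: form_to_der_def form_pairing_def differential_def sum_divide_distrib)
  qed
  then show ?thesis
    by (simp add: vec_eq_iff over_nth const_mat_def matrix_vector_mult_def)
qed

lemma wedge_differential_lin_over:
  "wedge (differential (lin c)) (over q \<zeta>) $ i $ j
    = to_fract (pconst (c i) * \<zeta> $ j - pconst (c j) * \<zeta> $ i) / to_fract q"
  by (simp add: wedge_def differential_def partial_lin over_nth diff_divide_distrib)

section \<open>Transfer from \<open>cleared\<close> to vectors with denominator
  \<open>QN\<close>\<close>

context linear_form_family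
begin

text \<open>\<open>L H\<close> divides \<open>QN\<close> exactly \<open>e H\<close> times, since it
  does not divide the other linear forms.\<close>

lemma regular_along_over_QN_iff:
  assumes "H \<in> N"
  shows "regular_along (L H) (to_fract y / to_fract QN) \<longleftrightarrow> L H ^ e H dvd y"
proof -
  have QN: "QN = L H ^ e H * (\<Prod>H\<in>N - {H}. L H ^ e H)"
    using assms finite by (simp add: QN_def prod.remove[of _ H])
  have prime: "prime_elem (L H)"
    using prime_L assms by blast
  moreover have "\<not> L H dvd (\<Prod>H\<in>N - {H}. L H ^ e H)"
    using prime assms not_dvd by (intro prime_elem_not_dvd_prod_power; blast)
  ultimately show ?thesis
    unfolding QN by (rule regular_along_fract_iff)
qed

lemma form_cond_iff_regular:
  "H \<in> N \<Longrightarrow> form_cond H \<zeta> \<longleftrightarrow>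
     regular_2form_along (L H) (wedge (differential (L H)) (over QN \<zeta>))"
  by (simp only: form_cond_def regular_2form_along_def wedge_differential_lin_over
      regular_along_over_QN_iff)

lemma der_cond_iff_dvd: "der_cond H \<eta> \<longleftrightarrow> L H ^ e H dvd der_apply \<eta> (L H)"
  by (simp add: der_cond_def der_apply_def partial_lin mult.commute)

theorem saito_criterion:
  assumes M: "M = over QN ` cleared" and "\<And>j. \<theta> j \<in> M"
  shows "is_S_basis \<theta> M \<longleftrightarrow>
    (\<exists>k. k \<noteq> 0 \<and> det (coeff_matrix \<theta>) = to_fract (pconst k) * (to_fract QP / to_fract QN))"
proof -
  have "\<forall>j. \<exists>\<eta>. \<eta> \<in> cleared \<and> \<theta> j = over QN \<eta>"
    using assms by blast
  then obtain \<eta> where \<eta>: "\<forall>j. \<eta> j \<in> cleared \<and> \<theta> j = over QN (\<eta> j)"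
    by (auto dest!: choice)
  then have cleared: "\<eta> j \<in> cleared" for j by blast
  from \<eta> have \<theta>: "\<theta> = (\<lambda>j. over QN (\<eta> j))" by auto
  have comb: "(\<Sum>j\<in>UNIV. S_scale (f j) (\<theta> j)) = over QN (\<Sum>j\<in>UNIV. f j *s \<eta> j)" for f
    by (simp add: \<theta> over_sum)
  have det: "det (coeff_matrix \<theta>) = to_fract (pconst k) * (to_fract QP / to_fract QN)
      \<longleftrightarrow> det (of_cols \<eta>) = pconst k * target" for k
  proof -
    have "to_fract QN ^ CARD('n) = to_fract QN * to_fract (QN ^ (CARD('n) - 1))"
      by (simp add: to_fract_power flip: power_Suc)
    then have "det (coeff_matrix \<theta>) = to_fract (pconst k) * (to_fract QP / to_fract QN)
      \<longleftrightarrow> to_fract (det (of_cols \<eta>)) = to_fract (pconst k * target)"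
      unfolding \<theta> det_coeff_matrix_over target_def
      by (simp add: field_simps QN_nonzero)
    then show ?thesis by (simp only: to_fract_eq_iff)
  qed
  show ?thesis
  proof
    assume "is_S_basis \<theta> M"
    then have range: "range (\<lambda>f. \<Sum>j\<in>UNIV. S_scale (f j) (\<theta> j)) = M"
      by (simp add: is_S_basis_iff)
    \<comment> \<open>Division by \<open>QN\<close> is injective, so spanning \<open>M\<close> is
      the same as spanning \<open>cleared\<close>.\<close>
    have spanning: "\<exists>f. v = (\<Sum>j\<in>UNIV. f j *s \<eta> j)" if "v \<in> cleared" for v
    proof -
      have "over QN v \<in> range (\<lambda>f. over QN (\<Sum>j\<in>UNIV. f j *s \<eta> j))"
        using that unfolding range[unfolded comb] M by (rule imageI)
      then show ?thesis
        by (auto simp: over_eq_iff QN_nonzero)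
    qed
    obtain k where "k \<noteq> 0" "det (of_cols \<eta>) = pconst k * target"
      by (rule det_eq_target_if_spanning[of \<eta>, OF cleared spanning])
    then show "\<exists>k. k \<noteq> 0 \<and> det (coeff_matrix \<theta>) = to_fract (pconst k) * (to_fract QP / to_fract QN)"
      using det by blast
  next
    assume "\<exists>k. k \<noteq> 0 \<and> det (coeff_matrix \<theta>) = to_fract (pconst k) * (to_fract QP / to_fract QN)"
    then obtain k where k: "k \<noteq> 0" "det (of_cols \<eta>) = pconst k * target"
      using det by blast
    have "f j = 0" if "(\<Sum>j\<in>UNIV. S_scale (f j) (\<theta> j)) = 0" for f j
    proof (rule independent_if_det_nonzero)
      show "det (of_cols \<eta>) \<noteq> 0" using k target_nonzero by simp
      have "over QN (\<Sum>j\<in>UNIV. f j *s \<eta> j) = over QN 0"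
        using that unfolding comb by (simp add: vec_eq_iff over_nth)
      then show "(\<Sum>j\<in>UNIV. f j *s \<eta> j) = 0"
        by (simp add: over_eq_iff QN_nonzero)
    qed
    moreover have "range (\<lambda>f. \<Sum>j\<in>UNIV. S_scale (f j) (\<theta> j)) = M"
    proof
      show "range (\<lambda>f. \<Sum>j\<in>UNIV. S_scale (f j) (\<theta> j)) \<subseteq> M"
        unfolding comb M by (intro image_subsetI imageI cleared_sum cleared)
      show "M \<subseteq> range (\<lambda>f. \<Sum>j\<in>UNIV. S_scale (f j) (\<theta> j))"
      proof
        fix w
        assume "w \<in> M"
        then obtain v where v: "v \<in> cleared" "w = over QN v" unfolding M by blast
        obtain f where "v = (\<Sum>j\<in>UNIV. f j *s \<eta> j)"
          using spanning_if_det_eq_target[of \<eta>, OF cleared k v(1)] ..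
        then show "w \<in> range (\<lambda>f. \<Sum>j\<in>UNIV. S_scale (f j) (\<theta> j))"
          unfolding comb v(2) by simp
      qed
    qed
    ultimately show "is_S_basis \<theta> M"
      by (simp add: is_S_basis_iff)
  qed
qed

end

section \<open>The inner product and the linear forms\<close>

lemma sum_representation_family:
  fixes x :: "'n::finite \<Rightarrow> 'w::real_vector"
  assumes "inj x" "independent (range x)" "span (range x) = UNIV"
  shows "(\<Sum>i\<in>UNIV. representation (range x) f (x i) *\<^sub>R x i) = f"
proof -
  have "(\<Sum>b\<in>range x. representation (range x) f b *\<^sub>R b) = f"
    using assms(2,3) by (intro real_vector.sum_representation_eq) auto
  then show ?thesis using assms(1) by (simp add: sum.reindex)
qed

text \<open>If the Gram matrix kills \<open>u\<close>, then the combination \<open>w\<close> of the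
  \<open>x j\<close> with coefficients \<open>u\<close> is orthogonal to every \<open>x i\<close>,
  hence to itself. So \<open>w = 0\<close> by positivity and \<open>u = 0\<close> by
  independence.\<close>

lemma gram_left_inverse:
  fixes x :: "'n::finite \<Rightarrow> 'w::real_vector"
  assumes "inj x" "independent (range x)" "inner_product_on_type I"
  obtains B :: "real^'n^'n" where "B ** (\<chi> i j. I (x i) (x j)) = mat 1"
proof -
  let ?G = "(\<chi> i j. I (x i) (x j)) :: real^'n^'n"
  have bil: "bilinear I" and pos: "\<And>w. w \<noteq> 0 \<Longrightarrow> I w w > 0"
    using assms(3) by (auto simp: inner_product_on_type_def)
  have "u = 0" if u: "?G *v u = 0" for u
  proof -
    define w where "w = (\<Sum>j\<in>UNIV. u $ j *\<^sub>R x j)"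
    have right: "I v w = (\<Sum>j\<in>UNIV. u $ j * I v (x j))" for v
      using bil unfolding bilinear_def w_def
      by (simp add: linear_sum linear_cmul)
    have left: "I w v = (\<Sum>i\<in>UNIV. u $ i * I (x i) v)" for v
    proof -
      have "linear (\<lambda>y. I y v)" using bil by (simp add: bilinear_def)
      then show ?thesis
        by (simp add: w_def linear_sum[of "\<lambda>y. I y v"] linear_cmul[of "\<lambda>y. I y v"])
    qed
    have "I (x i) w = (?G *v u) $ i" for i
      by (simp add: right matrix_vector_mult_def mult.commute)
    then have "I w w = 0"
      using u by (simp add: left)
    then have w: "w = 0" using pos by force
    have "u $ i = 0" for i
    proof -
      have "(\<Sum>b\<in>range x. u $ inv x b *\<^sub>R b) = 0"
        using w assms(1) by (simp add: w_def sum.reindex)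
      then have "u $ inv x (x i) = 0"
        using real_vector.independentD[OF assms(2) _ subset_refl, of "\<lambda>b. u $ inv x b" "x i"]
        by simp
      then show ?thesis using assms(1) by simp
    qed
    then show "u = 0" by (simp add: vec_eq_iff)
  qed
  then show thesis
    using that matrix_left_invertible_ker[of ?G] by blast
qed

lemma hyperplane_functional_nonzero:
  fixes a :: "'v::euclidean_space \<Rightarrow>\<^sub>L real"
  assumes "linear_hyperplane H" "{v. blinfun_apply a v = 0} = H"
  shows "a \<noteq> 0"
proof
  assume "a = 0"
  then have "H = UNIV" using assms(2) by auto
  then show False using assms(1) by (simp add: linear_hyperplane_def)
qed

definition coords ::
  "('n \<Rightarrow> 'v::euclidean_space \<Rightarrow>\<^sub>L real) \<Rightarrow> ('v \<Rightarrow>\<^sub>L real) \<Rightarrow> 'n \<Rightarrow> complex" where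
  "coords x f i = complex_of_real (representation (range x) f (x i))"

lemma linform_eq_lin: "linform x f = lin (coords x f)"
  by (simp add: linform_def lin_def coords_def)

lemma coords_nonzero:
  fixes x :: "'n::finite \<Rightarrow> 'v::euclidean_space \<Rightarrow>\<^sub>L real"
  assumes "inj x" "independent (range x)" "span (range x) = UNIV" "f \<noteq> 0"
  shows "\<exists>i. coords x f i \<noteq> 0"
proof (rule ccontr)
  assume "\<not> ?thesis"
  then have "(\<Sum>i\<in>UNIV. representation (range x) f (x i) *\<^sub>R x i) = 0"
    by (simp add: coords_def)
  with assms(4) show False
    unfolding sum_representation_family[OF assms(1-3)] by contradiction
qed

text \<open>The two forms are proportional over the complex numbers, and the ratio is real because
  the coordinates are, so the functionals themselves are proportional. This makes distinct
  hyperplanes give non-associated primes.\<close>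

lemma linform_dvd_imp_ker_eq:
  fixes x :: "'n::{finite,linorder} \<Rightarrow> 'v::euclidean_space \<Rightarrow>\<^sub>L real"
  assumes x: "inj x" "independent (range x)" "span (range x) = UNIV"
    and "f \<noteq> 0" "g \<noteq> 0" "lin (coords x f) dvd lin (coords x g)"
  shows "{v. blinfun_apply f v = 0} = {v. blinfun_apply g v = 0}"
proof -
  let ?r = "\<lambda>f i. representation (range x) f (x i)"
  obtain p where p: "coords x f p \<noteq> 0"
    using coords_nonzero[OF x \<open>f \<noteq> 0\<close>] by blast
  define t where "t = ?r g p / ?r f p"
  have "complex_of_real (?r g i) = complex_of_real (t * ?r f i)" for i
    using lin_dvd_linD[of "coords x f" p "coords x g" i] p assms(6)
    by (simp add: coords_def t_def)
  then have "?r g i = t * ?r f i" for i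
    by (simp only: of_real_eq_iff)
  then have "(\<Sum>i\<in>UNIV. ?r g i *\<^sub>R x i) = t *\<^sub>R (\<Sum>i\<in>UNIV. ?r f i *\<^sub>R x i)"
    by (simp add: scaleR_sum_right)
  then have g: "g = t *\<^sub>R f"
    unfolding sum_representation_family[OF x] .
  then have "t \<noteq> 0" using \<open>g \<noteq> 0\<close> by auto
  then show ?thesis by (simp add: g blinfun.scaleR_left)
qed

theorem theorem1p4:
  fixes x :: "'n::{finite,linorder} \<Rightarrow> 'v::euclidean_space \<Rightarrow>\<^sub>L real"
    and I :: "('v \<Rightarrow>\<^sub>L real) \<Rightarrow> ('v \<Rightarrow>\<^sub>L real) \<Rightarrow> real"
    and \<A> :: "'v set set"
    and \<alpha> :: "'v set \<Rightarrow> 'v \<Rightarrow>\<^sub>L real"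
    and m :: "'v set \<Rightarrow> int"
    and \<theta> :: "'n \<Rightarrow> 'n K_vec"
  assumes basis: "inj x" "independent (range x)" "span (range x) = UNIV"
    and inner_product: "inner_product_on_type I"
    and arrangement: "finite \<A>" "\<And>H. H \<in> \<A> \<Longrightarrow> linear_hyperplane H"
    and kernel: "\<And>H. H \<in> \<A> \<Longrightarrow> {v. blinfun_apply (\<alpha> H) v = 0} = H"
    and members: "\<And>j. \<theta> j \<in> gen_log_module x I \<alpha> \<A> m"
  shows "is_S_basis \<theta> (gen_log_module x I \<alpha> \<A> m) \<longleftrightarrow>
    (\<exists>c::complex. c \<noteq> 0 \<and>
       det (coeff_matrix \<theta>) =
         to_fract (pconst c) * (to_fract (Q_pos x \<alpha> \<A> m) / to_fract (Q_neg x \<alpha> \<A> m)))"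
proof -
  define c where "c H = coords x (\<alpha> H)" for H
  \<comment> \<open>One exponent function serves both parts: it agrees with
    \<open>pos_mult m\<close> on \<open>P\<close> and with \<open>neg_mult m\<close> on
    \<open>N\<close>.\<close>
  define e where "e H = nat \<bar>m H\<bar>" for H
  define P where "P = pos_part \<A> m"
  define N where "N = neg_part \<A> m"
  define G :: "'n C_mat" where "G = (\<chi> i j. complex_of_real (I (x i) (x j)))"
  \<comment> \<open>The inverse is found over the reals, where positivity makes sense, and then
    extended to the complex numbers.\<close>
  obtain B :: "((real, 'n) vec, 'n) vec" where B: "B ** (\<chi> i j. I (x i) (x j)) = mat 1"
    using gram_left_inverse[OF basis(1,2) inner_product] by blast
  define G' :: "'n C_mat" where "G' = (\<chi> i j. complex_of_real (B $ i $ j))"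
  have "(G' ** G) $ i $ j = complex_of_real ((B ** (\<chi> i j. I (x i) (x j))) $ i $ j)" for i j
    by (simp add: G_def G'_def matrix_matrix_mult_def)
  then have inverse: "G' ** G = mat 1"
    unfolding B by (simp add: vec_eq_iff mat_def)
  have sub: "H \<in> \<A>" if "H \<in> P \<union> N" for H
    using that by (auto simp: P_def N_def pos_part_def neg_part_def)
  have nz: "\<alpha> H \<noteq> 0" if "H \<in> \<A>" for H
    using hyperplane_functional_nonzero arrangement(2) kernel that by blast
  have not_dvd: "\<not> lin (c H) dvd lin (c H')" if "H \<in> P \<union> N" "H' \<in> P \<union> N" "H \<noteq> H'" for H H'
  proof
    have A: "H \<in> \<A>" "H' \<in> \<A>" using sub that by blast+
    assume "lin (c H) dvd lin (c H')"
    then have "{v. blinfun_apply (\<alpha> H) v = 0} = {v. blinfun_apply (\<alpha> H') v = 0}"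
      unfolding c_def using nz A by (intro linform_dvd_imp_ker_eq[OF basis])
    then show False using that(3) unfolding kernel[OF A(1)] kernel[OF A(2)] by contradiction
  qed
  interpret linear_form_family c P N e G G'
  proof
    show "finite P" "finite N"
      using arrangement(1) by (simp_all add: P_def N_def pos_part_def neg_part_def)
    show "P \<inter> N = {}"
      by (auto simp: P_def N_def pos_part_def neg_part_def)
    show "\<exists>i. c H i \<noteq> 0" if "H \<in> P \<union> N" for H
      unfolding c_def by (rule coords_nonzero[OF basis nz[OF sub[OF that]]])
  qed (fact not_dvd inverse)+
  have L: "linform x (\<alpha> H) = L H" for H
    by (simp add: linform_eq_lin c_def)
  have eP: "pos_mult m H = e H" if "H \<in> P" for H
    using that by (simp add: P_def pos_part_def pos_mult_def e_def)
  have eN: "neg_mult m H = e H" if "H \<in> N" for H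
    using that by (simp add: N_def neg_part_def neg_mult_def e_def)
  have Q_pos: "Q_pos x \<alpha> \<A> m = QP"
    unfolding Q_pos_def Q_poly_def QP_def P_def[symmetric] L by (rule prod.cong) (simp_all add: eP)
  have Q_neg: "Q_poly x \<alpha> N (neg_mult m) = QN"
    unfolding Q_poly_def QN_def L by (rule prod.cong) (simp_all add: eN)
  \<comment> \<open>The other side of the inverse shows that every derivation comes from a
    form.\<close>
  have "G ** G' = mat 1"
    using inverse matrix_left_right_inverse by blast
  then have G_inverse: "const_mat G *v (const_mat G' *v \<eta>) = \<eta>" for \<eta>
    by (simp add: matrix_vector_mul_assoc const_mat_1 flip: const_mat_mult)
  have I_sym: "I f g = I g f" for f g
    using inner_product by (simp add: inner_product_on_type_def)
  have to_der: "form_to_der x I (over QN \<zeta>) = over QN (const_mat G *v \<zeta>)" for \<zeta>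
    unfolding G_def by (rule form_to_der_over) (rule I_sym)
  have "log_der x \<alpha> P (pos_mult m) = {\<eta>. \<forall>H\<in>P. der_cond H \<eta>}"
    unfolding log_der_def L der_cond_iff_dvd by (auto simp: eP)
  moreover have "log_form x \<alpha> N (neg_mult m) = over QN ` {\<zeta>. \<forall>H\<in>N. form_cond H \<zeta>}"
  proof -
    have "log_form x \<alpha> N (neg_mult m) = {\<omega>. (\<exists>\<eta>. \<omega> = over QN \<eta>) \<and>
        (\<forall>H\<in>N. regular_2form_along (L H) (wedge (differential (L H)) \<omega>))}"
      unfolding log_form_def Q_neg L over_def ..
    then show ?thesis by (auto simp: form_cond_iff_regular)
  qed
  ultimately have "gen_log_module x I \<alpha> \<A> m =
      over QN ` {\<eta>. \<forall>H\<in>P. der_cond H \<eta>} \<inter>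
      (\<lambda>\<zeta>. over QN (const_mat G *v \<zeta>)) ` {\<zeta>. \<forall>H\<in>N. form_cond H \<zeta>}"
    unfolding gen_log_module_def P_def[symmetric] N_def[symmetric] Q_neg_def Q_neg over_def[symmetric]
    by (simp add: image_image to_der)
  also have "\<dots> = over QN ` cleared"
  proof (intro equalityI subsetI)
    fix w
    assume "w \<in> over QN ` {\<eta>. \<forall>H\<in>P. der_cond H \<eta>} \<inter>
      (\<lambda>\<zeta>. over QN (const_mat G *v \<zeta>)) ` {\<zeta>. \<forall>H\<in>N. form_cond H \<zeta>}"
    then obtain \<eta> \<zeta> where *: "w = over QN \<eta>" "\<forall>H\<in>P. der_cond H \<eta>"
      "w = over QN (const_mat G *v \<zeta>)" "\<forall>H\<in>N. form_cond H \<zeta>"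
      by (elim IntE imageE CollectE)
    \<comment> \<open>The two descriptions of \<open>w\<close> have the same denominator, so their
      numerators agree and \<open>\<zeta>\<close> is recovered from \<open>\<eta>\<close> by
      \<open>G'\<close>.\<close>
    then have "\<eta> = const_mat G *v \<zeta>"
      using over_eq_iff[OF QN_nonzero] by simp
    with * have "\<eta> \<in> cleared"
      by (simp add: cleared_def const_mat_inverse)
    with * show "w \<in> over QN ` cleared" by blast
  next
    fix w
    assume "w \<in> over QN ` cleared"
    then obtain \<eta> where "w = over QN \<eta>" "\<eta> \<in> cleared" by blast
    moreover from this have "w = over QN (const_mat G *v (const_mat G' *v \<eta>))"
      by (simp add: G_inverse)
    ultimately show "w \<in> over QN ` {\<eta>. \<forall>H\<in>P. der_cond H \<eta>} \<inter>
      (\<lambda>\<zeta>. over QN (const_mat G *v \<zeta>)) ` {\<zeta>. \<forall>H\<in>N. form_cond H \<zeta>}"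
      unfolding cleared_def by blast
  qed
  finally have "gen_log_module x I \<alpha> \<A> m = over QN ` cleared" .
  moreover have "Q_neg x \<alpha> \<A> m = QN"
    unfolding Q_neg_def N_def[symmetric] by (rule Q_neg)
  ultimately show ?thesis
    unfolding Q_pos using saito_criterion[OF _ members] by simp
qed

end
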